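(* Let $\mathfrak{E}$ be the steering ellipsoid of a two-qubit X state with $\ell_3>0$, with horizontal average entropy $\overline{S}_{\leftrightarrow}$ and vertical average entropy $\overline{S}_{\updownarrow}$ on $[z_H,z_G]$. Suppose that it is not the case that $\overline{S}_{\leftrightarrow}(z)>\overline{S}_{\updownarrow}(z)$ for all $z\in(z_H,z_G)$, and that $\overline{S}_{\leftrightarrow}$ is neither convex nor concave on $[z_H,z_G]$. Then some X states having steering ellipsoid $\mathfrak{E}$ admit an optimal three-state decomposition of $\rho^B$. Moreover, the components of the optimal three-state decomposition are the same for all these X states: there are three fixed points $B_1,B_2,B_3$ of the ellipse $\mathbf{E}$ such that, for every X state with steering ellipsoid $\mathfrak{E}$ admitting an optimal three-state decomposition, the optimal three-state decomposition is the expression of $B$ as a convex combination of $B_1,B_2,B_3$.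
   Context: An X state (up to local unitaries) is a two-qubit density matrix, in the product basis $|00\rangle,|01\rangle,|10\rangle,|11\rangle$ (first factor $A$, second factor $B$), $$\rho^{AB}=\begin{pmatrix} a & 0 & 0 & u \\ 0 & b & v & 0 \\ 0 & v & c & 0 \\ u & 0 & 0 & d \end{pmatrix},$$ with $a,b,c,d\ge 0$, $a+b+c+d=1$, $u,v\ge 0$, $u^2\le ad$, $v^2\le bc$; it is assumed that $(a+b)(c+d)>0$. Put $$\ell_1=\tfrac{u+v}{\sqrt{(a+b)(c+d)}},\quad \ell_2=\tfrac{|u-v|}{\sqrt{(a+b)(c+d)}},\quad \ell_3=\tfrac{|ad-bc|}{(a+b)(c+d)},\quad z_0=\tfrac{ac-bd}{(a+b)(c+d)}.$$ The steering ellipsoid $\mathfrak{E}$ is the ellipsoid in $\mathbb{R}^3$ with surface $x^2/\ell_1^2+y^2/\ell_2^2+(z-z_0)^2/\ell_3^2=1$ (in degenerate cases, the surface is the set $\{(\ell_1n_1,\ell_2n_2,z_0+\ell_3n_3): n_1^2+n_2^2+n_3^2=1\}$); it lies in the closed unit ball. The ellipse $\mathbf{E}$ is the section $y=0$ of the surface, $x^2/\ell_1^2+(z-z_0)^2/\ell_3^2=1$ (in degenerate cases $\{(\ell_1 n_1,z_0+\ell_3 n_3): n_1^2+n_3^2=1\}$). Put $z_G=z_0+\ell_3$, $z_H=z_0-\ell_3$; $G=(0,z_G)$ and $H=(0,z_H)$ are the upper and lower vertices of $\mathbf{E}$. The reduced state $\rho^B$ has Bloch vector $B=(0,0,z_B)$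 with $z_B=a-b+c-d$. Let $h(x)=-\frac{1+x}{2}\log_2\frac{1+x}{2}-\frac{1-x}{2}\log_2\frac{1-x}{2}$ for $x\in[0,1]$ (with $0\log_2 0=0$). A point $X$ at distance $|OX|$ from the origin represents a qubit state with von Neumann entropy $S_X=h(|OX|)$. A decomposition of $\rho^B$ is an expression of $B$ as a finite convex combination $B=\sum_ip_iB_i$ of points $B_i$ on the surface of $\mathfrak{E}$ (these are the post-measurement ensembles of qubit $B$ obtained from rank-1 POVMs on $A$). Its average entropy is $\sum_ip_iS_{B_i}$. A decomposition is optimal if it attains the minimum of the average entropy over all decompositions of $\rho^B$. A three-state decomposition is a decomposition (with positive weights) into three points of $\mathbf{E}$ that are either $G$ together with the two points of $\mathbf{E}$ having $z$-coordinate $z_1$ for some $z_1\in(z_H,z_B)$, the latter two with equal weights (upper-triangle), or $H$ together with the two points of $\mathbf{E}$ having $z$-coordinate $z_2$ for some $z_2\in(z_B,z_G)$, the latter two with equal weights (lower-triangle). The horizontal average entropy is $\overline{S}_{\leftrightarrow}(z)=h(r(z))$, $z\in[z_H,z_G]$, with $r(z)=\big[z^2+\ell_1^2\big(1-(z-z_0)^2/\ell_3^2\big)\big]^{1/2}$ (the average entropy of the equal-weight decomposition of $(0,z)$ into the two points of $\mathbf{E}$ at height $z$). The vertical average entropy is $\overline{S}_{\updownarrow}(z)=\frac{z-z_H}{z_G-z_H}S_G+\frac{z_G-z}{z_G-z_H}S_H$ (the average entropy of the decomposition of $(0,z)$ into $G$ and $H$). *)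

theory Defs
  imports "HOL-Analysis.Analysis"
begin

(* Rows and columns 1, 2, 3, 4 stand for the product basis |00>, |01>, |10>, |11>
   (first factor A, second factor B). *)
definition X_matrix :: "real \<Rightarrow> real \<Rightarrow> real \<Rightarrow> real \<Rightarrow> real \<Rightarrow> real \<Rightarrow> complex^4^4" where
  "X_matrix a b c d u v = vector
     [vector [of_real a, 0, 0, of_real u],
      vector [0, of_real b, of_real v, 0],
      vector [0, of_real v, of_real c, 0],
      vector [of_real u, 0, 0, of_real d]]"

(* The inequalities u^2 <= a d and v^2 <= b c, together with nonnegativity of the diagonal,
   express positive semidefiniteness. The last condition says that the two outcomes of the
   measurement of A in the standard basis both have positive probability. *)
definition X_state :: "complex^4^4 \<Rightarrow> bool" where
  "X_state \<rho> \<longleftrightarrow> (\<exists>a b c d u v. \<rho> = X_matrix a b c d u v \<and>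
     0 \<le> a \<and> 0 \<le> b \<and> 0 \<le> c \<and> 0 \<le> d \<and> a + b + c + d = 1 \<and>
     0 \<le> u \<and> 0 \<le> v \<and> u\<^sup>2 \<le> a * d \<and> v\<^sup>2 \<le> b * c \<and> (a + b) * (c + d) > 0)"

definition entry_a :: "complex^4^4 \<Rightarrow> real" where "entry_a \<rho> = Re (\<rho> $ 1 $ 1)"
definition entry_b :: "complex^4^4 \<Rightarrow> real" where "entry_b \<rho> = Re (\<rho> $ 2 $ 2)"
definition entry_c :: "complex^4^4 \<Rightarrow> real" where "entry_c \<rho> = Re (\<rho> $ 3 $ 3)"
definition entry_d :: "complex^4^4 \<Rightarrow> real" where "entry_d \<rho> = Re (\<rho> $ 4 $ 4)"
definition entry_u :: "complex^4^4 \<Rightarrow> real" where "entry_u \<rho> = Re (\<rho> $ 1 $ 4)"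
definition entry_v :: "complex^4^4 \<Rightarrow> real" where "entry_v \<rho> = Re (\<rho> $ 2 $ 3)"

lemma entry_X_matrix [simp]:
  "entry_a (X_matrix a b c d u v) = a"
  "entry_b (X_matrix a b c d u v) = b"
  "entry_c (X_matrix a b c d u v) = c"
  "entry_d (X_matrix a b c d u v) = d"
  "entry_u (X_matrix a b c d u v) = u"
  "entry_v (X_matrix a b c d u v) = v"
  by (simp_all add: entry_a_def entry_b_def entry_c_def entry_d_def entry_u_def entry_v_def
      X_matrix_def vector_def)

definition norm_factor :: "complex^4^4 \<Rightarrow> real" where
  "norm_factor \<rho> = (entry_a \<rho> + entry_b \<rho>) * (entry_c \<rho> + entry_d \<rho>)"

definition ell1 :: "complex^4^4 \<Rightarrow> real" where
  "ell1 \<rho> = (entry_u \<rho> + entry_v \<rho>) / sqrt (norm_factor \<rho>)"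

definition ell2 :: "complex^4^4 \<Rightarrow> real" where
  "ell2 \<rho> = \<bar>entry_u \<rho> - entry_v \<rho>\<bar> / sqrt (norm_factor \<rho>)"

definition ell3 :: "complex^4^4 \<Rightarrow> real" where
  "ell3 \<rho> = \<bar>entry_a \<rho> * entry_d \<rho> - entry_b \<rho> * entry_c \<rho>\<bar> / norm_factor \<rho>"

definition z_center :: "complex^4^4 \<Rightarrow> real" where
  "z_center \<rho> = (entry_a \<rho> * entry_c \<rho> - entry_b \<rho> * entry_d \<rho>) / norm_factor \<rho>"

(* The surface is given by its parametrization by the unit sphere, which also covers vanishing
   semiaxes; steering_surface_eq below gives the usual equation for positive ones.
   The solid ellipsoid is parametrized by the unit ball in the same way. *)
definition steering_surface :: "complex^4^4 \<Rightarrow> (real^3) set" where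
  "steering_surface \<rho> =
     {vector [ell1 \<rho> * n1, ell2 \<rho> * n2, z_center \<rho> + ell3 \<rho> * n3] | n1 n2 n3.
        n1\<^sup>2 + n2\<^sup>2 + n3\<^sup>2 = 1}"

definition steering_ellipsoid :: "complex^4^4 \<Rightarrow> (real^3) set" where
  "steering_ellipsoid \<rho> =
     {vector [ell1 \<rho> * n1, ell2 \<rho> * n2, z_center \<rho> + ell3 \<rho> * n3] | n1 n2 n3.
        n1\<^sup>2 + n2\<^sup>2 + n3\<^sup>2 \<le> 1}"

(* The ellipse lies in the plane y = 0 and is kept as a set of points of 3-space.
   It is the section y = 0 of the surface when ell2 > 0; for ell2 = 0 that section would be
   the filled ellipse, so the parametrization is used throughout. *)
definition steering_ellipse :: "complex^4^4 \<Rightarrow> (real^3) set" where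
  "steering_ellipse \<rho> =
     {vector [ell1 \<rho> * n1, 0, z_center \<rho> + ell3 \<rho> * n3] | n1 n3. n1\<^sup>2 + n3\<^sup>2 = 1}"

lemma steering_surface_eq:
  assumes "ell1 \<rho> > 0" "ell2 \<rho> > 0" "ell3 \<rho> > 0"
  shows "steering_surface \<rho> =
    {P. (P$1)\<^sup>2 / (ell1 \<rho>)\<^sup>2 + (P$2)\<^sup>2 / (ell2 \<rho>)\<^sup>2 + (P$3 - z_center \<rho>)\<^sup>2 / (ell3 \<rho>)\<^sup>2 = 1}"
    (is "_ = ?R")
proof
  show "steering_surface \<rho> \<subseteq> ?R"
    using assms by (auto simp: steering_surface_def power_mult_distrib)
  show "?R \<subseteq> steering_surface \<rho>"
  proof
    fix P assume "P \<in> ?R"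
    moreover have "P = vector [ell1 \<rho> * (P$1 / ell1 \<rho>), ell2 \<rho> * (P$2 / ell2 \<rho>),
        z_center \<rho> + ell3 \<rho> * ((P$3 - z_center \<rho>) / ell3 \<rho>)]"
      using assms by (simp add: vec_eq_iff forall_3)
    ultimately show "P \<in> steering_surface \<rho>"
      unfolding steering_surface_def mem_Collect_eq
      by (metis (no_types, lifting) power_divide)
  qed
qed

lemma steering_ellipse_eq:
  assumes "ell1 \<rho> > 0" "ell3 \<rho> > 0"
  shows "steering_ellipse \<rho> =
    {P. P$2 = 0 \<and> (P$1)\<^sup>2 / (ell1 \<rho>)\<^sup>2 + (P$3 - z_center \<rho>)\<^sup>2 / (ell3 \<rho>)\<^sup>2 = 1}"
    (is "_ = ?R")
proof
  show "steering_ellipse \<rho> \<subseteq> ?R"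
    using assms by (auto simp: steering_ellipse_def power_mult_distrib)
  show "?R \<subseteq> steering_ellipse \<rho>"
  proof
    fix P assume "P \<in> ?R"
    moreover from this have "P = vector [ell1 \<rho> * (P$1 / ell1 \<rho>), 0,
        z_center \<rho> + ell3 \<rho> * ((P$3 - z_center \<rho>) / ell3 \<rho>)]"
      using assms by (simp add: vec_eq_iff forall_3)
    ultimately show "P \<in> steering_ellipse \<rho>"
      unfolding steering_ellipse_def mem_Collect_eq
      by (metis (no_types, lifting) power_divide)
  qed
qed

definition z_G :: "complex^4^4 \<Rightarrow> real" where "z_G \<rho> = z_center \<rho> + ell3 \<rho>"
definition z_H :: "complex^4^4 \<Rightarrow> real" where "z_H \<rho> = z_center \<rho> - ell3 \<rho>"

definition vertex_G :: "complex^4^4 \<Rightarrow> real^3" where "vertex_G \<rho> = vector [0, 0, z_G \<rho>]"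
definition vertex_H :: "complex^4^4 \<Rightarrow> real^3" where "vertex_H \<rho> = vector [0, 0, z_H \<rho>]"

definition z_B :: "complex^4^4 \<Rightarrow> real" where
  "z_B \<rho> = entry_a \<rho> - entry_b \<rho> + entry_c \<rho> - entry_d \<rho>"

definition bloch_B :: "complex^4^4 \<Rightarrow> real^3" where
  "bloch_B \<rho> = vector [0, 0, z_B \<rho>]"

(* Since log 2 0 is multiplied by 0 at x = 1 (and x = -1), the convention 0 log 0 = 0 holds. *)
definition bin_entropy :: "real \<Rightarrow> real" where
  "bin_entropy x = - ((1 + x) / 2) * log 2 ((1 + x) / 2) - ((1 - x) / 2) * log 2 ((1 - x) / 2)"

definition point_entropy :: "real^3 \<Rightarrow> real" where
  "point_entropy P = bin_entropy (norm P)"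

(* A convex combination is encoded by the finite set S of its points and the weight function p,
   of which only the values on S matter. Repeated points of an ensemble are merged by adding
   their weights, which changes neither the barycentre nor the average entropy. *)
definition decomposition :: "complex^4^4 \<Rightarrow> (real^3) set \<Rightarrow> (real^3 \<Rightarrow> real) \<Rightarrow> bool" where
  "decomposition \<rho> S p \<longleftrightarrow>
     finite S \<and> S \<subseteq> steering_surface \<rho> \<and> (\<forall>P\<in>S. 0 \<le> p P) \<and>
     sum p S = 1 \<and> (\<Sum>P\<in>S. p P *\<^sub>R P) = bloch_B \<rho>"

definition average_entropy :: "(real^3) set \<Rightarrow> (real^3 \<Rightarrow> real) \<Rightarrow> real" where
  "average_entropy S p = (\<Sum>P\<in>S. p P * point_entropy P)"

definition optimal_decomposition ::
    "complex^4^4 \<Rightarrow> (real^3) set \<Rightarrow> (real^3 \<Rightarrow> real) \<Rightarrow> bool" where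
  "optimal_decomposition \<rho> S p \<longleftrightarrow>
     decomposition \<rho> S p \<and>
     (\<forall>S' p'. decomposition \<rho> S' p' \<longrightarrow> average_entropy S p \<le> average_entropy S' p')"

definition upper_triangle :: "complex^4^4 \<Rightarrow> (real^3) set \<Rightarrow> (real^3 \<Rightarrow> real) \<Rightarrow> bool" where
  "upper_triangle \<rho> S p \<longleftrightarrow>
     (\<exists>z1\<in>{z_H \<rho><..<z_B \<rho>}. \<exists>P Q. P \<noteq> Q \<and>
        {X \<in> steering_ellipse \<rho>. X $ 3 = z1} = {P, Q} \<and>
        S = {vertex_G \<rho>, P, Q} \<and> p P = p Q)"

definition lower_triangle :: "complex^4^4 \<Rightarrow> (real^3) set \<Rightarrow> (real^3 \<Rightarrow> real) \<Rightarrow> bool" where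
  "lower_triangle \<rho> S p \<longleftrightarrow>
     (\<exists>z2\<in>{z_B \<rho><..<z_G \<rho>}. \<exists>P Q. P \<noteq> Q \<and>
        {X \<in> steering_ellipse \<rho>. X $ 3 = z2} = {P, Q} \<and>
        S = {vertex_H \<rho>, P, Q} \<and> p P = p Q)"

definition three_state_decomposition ::
    "complex^4^4 \<Rightarrow> (real^3) set \<Rightarrow> (real^3 \<Rightarrow> real) \<Rightarrow> bool" where
  "three_state_decomposition \<rho> S p \<longleftrightarrow>
     decomposition \<rho> S p \<and> (\<forall>P\<in>S. 0 < p P) \<and> (upper_triangle \<rho> S p \<or> lower_triangle \<rho> S p)"

definition S_horizontal :: "complex^4^4 \<Rightarrow> real \<Rightarrow> real" where
  "S_horizontal \<rho> z =
     bin_entropy (sqrt (z\<^sup>2 + (ell1 \<rho>)\<^sup>2 * (1 - (z - z_center \<rho>)\<^sup>2 / (ell3 \<rho>)\<^sup>2)))"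

definition S_vertical :: "complex^4^4 \<Rightarrow> real \<Rightarrow> real" where
  "S_vertical \<rho> z =
     (z - z_H \<rho>) / (z_G \<rho> - z_H \<rho>) * point_entropy (vertex_G \<rho>) +
     (z_G \<rho> - z) / (z_G \<rho> - z_H \<rho>) * point_entropy (vertex_H \<rho>)"

end

(* All average entropies are governed by the horizontal one: a point of the surface at height z
   has at least the entropy g z = h (r z), so the minimum over all decompositions of B is the
   convex envelope of g at z_B. If ell1 \<le> ell3, then (r z)^2 is convex and g is concave. Otherwise
   (r z)^2 = M - k (z - c)^2 with k > 0. If c lies strictly between z_H and z_G, then M \<le> 1, as the
   ellipsoid lies in the unit ball, and g is convex. Otherwise put w = (r z)^2, t = |z - c| and
   C w = w / (artanh (sqrt w))^2; the square of dg/dt is a constant times t^2 / C w, and C is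
   strictly concave, because C' w = (2 s - sinh (2 s)) / (2 s^3) for s = artanh (sqrt w). Hence the
   second derivative of g changes sign at most once; as g is neither convex nor concave, it is convex
   next to one vertex and concave next to the other one. The chord from the vertex on the concave
   side that is tangent to g is then the only chord of triangle type that is part of the convex
   envelope, and its point of contact is the height of the two other fixed points. Filtering qubit A
   moves z_B along the segment HG without changing the ellipsoid. *)
theory Submission
  imports Defs "HOL-Real_Asymp.Real_Asymp"
begin

section \<open>Strictly convex functions of one variable\<close>

text \<open>Uniqueness rests on strictness: a triangle with another base has to be beaten strictly,
  so pieces that are merely convex and concave would not single out the contact point. The
  hypothesis that \<open>S_horizontal\<close> is somewhere not above \<open>S_vertical\<close> keeps
  the contact point away from the far vertex; with contact there, the envelope would be the chord GH
  and no triangle would be optimal. The slope is squared because k t^2 = M - w makes its square a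
  multiple of (M - w) / C w, a function of w alone; its monotonicity in t is governed by the sign of
  C w + (M - w) C' w. A concave piece can arise only for M > 1, that is, when the apex of the
  parabola lies beyond the unit ball. The convex envelope itself is never constructed: a line below
  \<open>S_horizontal\<close> bounds every average entropy from below, and a decomposition into at
  most four points realises every chord from above.\<close>

definition strictly_convex :: "real \<Rightarrow> real \<Rightarrow> (real \<Rightarrow> real) \<Rightarrow> bool" where
  "strictly_convex a b f \<longleftrightarrow>
     (\<forall>x y z. a \<le> x \<and> x < y \<and> y < z \<and> z \<le> b \<longrightarrow> (z - x) * f y < (z - y) * f x + (y - x) * f z)"

definition strictly_concave :: "real \<Rightarrow> real \<Rightarrow> (real \<Rightarrow> real) \<Rightarrow> bool" where
  "strictly_concave a b f \<longleftrightarrow> strictly_convex a b (\<lambda>x. - f x)"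

lemma strictly_convexD:
  "strictly_convex a b f \<Longrightarrow> a \<le> x \<Longrightarrow> x < y \<Longrightarrow> y < z \<Longrightarrow> z \<le> b \<Longrightarrow>
     (z - x) * f y < (z - y) * f x + (y - x) * f z"
  by (simp add: strictly_convex_def)

lemma strictly_concaveD:
  assumes "strictly_concave a b f" "a \<le> x" "x < y" "y < z" "z \<le> b"
  shows "(z - y) * f x + (y - x) * f z < (z - x) * f y"
  using strictly_convexD[OF assms(1)[unfolded strictly_concave_def] assms(2-)] by simp

lemma strictly_convex_affine:
  assumes "strictly_convex a b f"
  shows "strictly_convex a b (\<lambda>x. f x - (m * x + n))"
  unfolding strictly_convex_def
proof (intro allI impI)
  fix x y z assume "a \<le> x \<and> x < y \<and> y < z \<and> z \<le> b"
  then have "(z - x) * f y < (z - y) * f x + (y - x) * f z"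
    using assms unfolding strictly_convex_def by blast
  then show "(z - x) * (f y - (m * y + n)) < (z - y) * (f x - (m * x + n)) + (y - x) * (f z - (m * z + n))"
    by (simp add: algebra_simps)
qed

lemma strictly_concave_affine:
  assumes "strictly_concave a b f"
  shows "strictly_concave a b (\<lambda>x. f x - (m * x + n))"
  using strictly_convex_affine[of a b "\<lambda>x. - f x" "-m" "-n"] assms
  by (simp add: strictly_concave_def algebra_simps)

lemma strictly_convex_reflect:
  assumes "strictly_convex a b f"
  shows "strictly_convex (s - b) (s - a) (\<lambda>x. f (s - x))"
  unfolding strictly_convex_def
proof (intro allI impI)
  fix x y z assume "s - b \<le> x \<and> x < y \<and> y < z \<and> z \<le> s - a"
  then show "(z - x) * f (s - y) < (z - y) * f (s - x) + (y - x) * f (s - z)"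
    using strictly_convexD[OF assms, of "s - z" "s - y" "s - x"] by (simp add: algebra_simps)
qed

lemma strictly_convex_shift:
  assumes "strictly_convex a b f"
  shows "strictly_convex (a + s) (b + s) (\<lambda>x. f (x - s))"
  unfolding strictly_convex_def
proof (intro allI impI)
  fix x y z assume "a + s \<le> x \<and> x < y \<and> y < z \<and> z \<le> b + s"
  then show "(z - x) * f (y - s) < (z - y) * f (x - s) + (y - x) * f (z - s)"
    using strictly_convexD[OF assms, of "x - s" "y - s" "z - s"] by (simp add: algebra_simps)
qed

lemma strictly_convex_imp_convex_on:
  assumes "strictly_convex a b f"
  shows "convex_on {a..b} f"
proof (rule convex_on_linorderI)
  fix t x y :: real
  assume t: "0 < t" "t < 1" and xy: "x \<in> {a..b}" "y \<in> {a..b}" "x < y"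
  let ?w = "(1 - t) * x + t * y"
  have e: "?w - x = t * (y - x)" "y - ?w = (1 - t) * (y - x)" by (simp_all add: algebra_simps)
  have "0 < t * (y - x)" "0 < (1 - t) * (y - x)" using t xy by auto
  with e have "0 < ?w - x" "0 < y - ?w" by simp_all
  then have "x < ?w" "?w < y" by simp_all
  then have "(y - x) * f ?w < (y - ?w) * f x + (?w - x) * f y"
    using strictly_convexD[OF assms] xy by auto
  then have "(y - x) * f ?w < ((1 - t) * (y - x)) * f x + (t * (y - x)) * f y"
    by (simp only: e)
  also have "\<dots> = (y - x) * ((1 - t) * f x + t * f y)" by (simp add: algebra_simps)
  finally have "f ?w < (1 - t) * f x + t * f y" using xy by simp
  then show "f ((1 - t) *\<^sub>R x + t *\<^sub>R y) \<le> (1 - t) * f x + t * f y"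
    using xy by simp
qed simp

lemma strictly_concave_imp_concave_on:
  "strictly_concave a b f \<Longrightarrow> concave_on {a..b} f"
  by (simp add: strictly_concave_def concave_on_def strictly_convex_imp_convex_on)

text \<open>Mean values on the two sides of the middle point are compared. Continuity takes the
  place of differentiability at the ends, where the ellipse may touch the unit sphere and the slope
  of the entropy diverge.\<close>

lemma strictly_convex_deriv:
  fixes f :: "real \<Rightarrow> real"
  assumes cont: "continuous_on {a..b} f"
    and der: "\<And>x. a < x \<Longrightarrow> x < b \<Longrightarrow> (f has_real_derivative f' x) (at x)"
    and mono: "\<And>x y. a < x \<Longrightarrow> x < y \<Longrightarrow> y < b \<Longrightarrow> f' x < f' y"
  shows "strictly_convex a b f"
  unfolding strictly_convex_def
proof (intro allI impI)
  fix x y z assume h: "a \<le> x \<and> x < y \<and> y < z \<and> z \<le> b"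
  have MV: "\<exists>s. u < s \<and> s < v \<and> f v - f u = (v - u) * f' s"
    if that: "a \<le> u" "u < v" "v \<le> b" for u v
  proof -
    have "continuous_on {u..v} f" using cont by (rule continuous_on_subset) (use that in auto)
    moreover have "f differentiable (at x)" if "u < x" "x < v" for x
      using der[of x] that \<open>a \<le> u\<close> \<open>v \<le> b\<close> by (auto simp: real_differentiable_def)
    ultimately obtain l s where s: "u < s" "s < v" "DERIV f s :> l" "f v - f u = (v - u) * l"
      using MVT[OF \<open>u < v\<close>, of f] by blast
    then show ?thesis using DERIV_unique[OF s(3) der[of s]] that by force
  qed
  obtain s1 where s1: "x < s1" "s1 < y" "f y - f x = (y - x) * f' s1" using MV[of x y] h by auto
  obtain s2 where s2: "y < s2" "s2 < z" "f z - f y = (z - y) * f' s2" using MV[of y z] h by auto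
  have "f' s1 < f' s2" using mono s1 s2 h by auto
  then have "(z - y) * (y - x) * f' s1 < (z - y) * (y - x) * f' s2"
    using h by (intro mult_strict_left_mono) auto
  then have "(z - y) * (f y - f x) < (y - x) * (f z - f y)" 
    unfolding s1(3) s2(3) by (simp add: mult_ac)
  then show "(z - x) * f y < (z - y) * f x + (y - x) * f z" by (simp add: algebra_simps)
qed

section \<open>Chords and the tangent chord of a convex-concave function\<close>

definition chord :: "(real \<Rightarrow> real) \<Rightarrow> real \<Rightarrow> real \<Rightarrow> real \<Rightarrow> real" where
  "chord f x y z = ((y - z) * f x + (z - x) * f y) / (y - x)"

lemma chord_affine:
  assumes "x < y"
  shows "chord (\<lambda>z. f z - (m * z + n)) x y z = chord f x y z - (m * z + n)"
proof -
  have "(y - z) * (f x - (m * x + n)) + (z - x) * (f y - (m * y + n))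
      = ((y - z) * f x + (z - x) * f y) - (y - x) * (m * z + n)"
    by (simp add: algebra_simps)
  then show ?thesis using assms by (simp add: chord_def diff_divide_distrib)
qed

lemma chord_reflect:
  "chord (\<lambda>z. f (- z)) (- y) (- x) (- z) = chord f x y z"
  by (simp add: chord_def algebra_simps)

text \<open>Subtracting the line through the right end point and \<open>T\<close>, where the slope towards the right
  end point is maximal, leaves a nonnegative function with the two zeros \<open>T\<close> and \<open>b\<close>.\<close>
lemma convex_concave_tangent:
  fixes f :: "real \<Rightarrow> real"
  assumes c: "a < c" "c < b" and cont: "continuous_on {a..b} f"
    and cvx: "strictly_convex a c f" and ccv: "strictly_concave c b f"
    and below: "a < z0" "z0 < b" "f z0 \<le> chord f a b z0"
  obtains T m n where "a < T" "T \<le> c" "f T = m * T + n" "f b = m * b + n"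
    "\<And>z. a \<le> z \<Longrightarrow> z < b \<Longrightarrow> z \<noteq> T \<Longrightarrow> m * z + n < f z"
proof -
  define s where "s z = (f b - f z) / (b - z)" for z
  \<comment> \<open>The maximum is sought on [a, c] only: the quotient degenerates at
    \<open>b\<close>, and beyond \<open>c\<close> concavity provides positivity.\<close>
  have "continuous_on {a..c} s" unfolding s_def
    by (intro continuous_intros continuous_on_subset[OF cont]) (use c in auto)
  then obtain T where T: "T \<in> {a..c}" "\<And>z. z \<in> {a..c} \<Longrightarrow> s z \<le> s T"
    using continuous_attains_sup[of "{a..c}" s] c by auto
  define m where "m = s T"
  define n where "n = f b - m * b"
  define D where "D z = f z - (m * z + n)" for z
  have Db: "D b = 0" by (simp add: D_def n_def)
  have D_s: "D z = (b - z) * (m - s z)" if "z < b" for z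
    using that by (simp add: D_def n_def s_def field_simps)
  have DT: "D T = 0" using D_s[of T] T c by (simp add: m_def)
  have Dcvx: "strictly_convex a c D" and Dccv: "strictly_concave c b D"
    unfolding D_def using strictly_convex_affine[OF cvx] strictly_concave_affine[OF ccv] by auto
  have D0: "0 \<le> D z" if "z \<in> {a..c}" for z
    using D_s[of z] T(2)[OF that] that c by (simp add: m_def)
  \<comment> \<open>A second zero would force a negative value midway between the two zeros.\<close>
  have Dpos1: "0 < D z" if "z \<in> {a..c}" "z \<noteq> T" for z
  proof (rule ccontr)
    assume "\<not> 0 < D z"
    then have "D z = 0" using D0 that by force
    let ?x = "min z T" and ?y = "max z T"
    have "(?y - ?x) * D ((?x + ?y) / 2) < (?y - (?x + ?y) / 2) * D ?x + ((?x + ?y) / 2 - ?x) * D ?y"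
      by (rule strictly_convexD[OF Dcvx]) (use that T(1) in auto)
    moreover have "D ?x = 0" "D ?y = 0" using \<open>D z = 0\<close> DT by (auto simp: min_def max_def)
    moreover have "0 \<le> D ((?x + ?y) / 2)" by (rule D0) (use that T(1) in auto)
    moreover have "0 < ?y - ?x" using that by auto
    ultimately show False by (auto simp: mult_less_0_iff)
  qed
  have Dpos2: "0 < D z" if "c < z" "z < b" for z
  proof -
    have "(b - z) * D c + (z - c) * D b < (b - c) * D z"
      by (rule strictly_concaveD[OF Dccv]) (use that in auto)
    moreover have "0 \<le> (b - z) * D c" using D0[of c] that c by auto
    ultimately have "0 < (b - c) * D z" by (simp add: Db)
    then show ?thesis using c by (simp add: zero_less_mult_iff)
  qed
  have pos: "0 < D z" if "a \<le> z" "z < b" "z \<noteq> T" for z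
    using Dpos1[of z] Dpos2[of z] that by (cases "z \<le> c") auto
  \<comment> \<open>With \<open>T = a\<close> the line would be the chord over the whole interval,
    and \<open>z0\<close> is a point where \<open>f\<close> does not exceed it, against the
    positivity of \<open>D\<close>.\<close>
  have "T \<noteq> a"
  proof
    assume "T = a"
    have "D z0 \<le> chord D a b z0"
      unfolding D_def using below chord_affine[of a b f m n z0] by simp
    also have "\<dots> = 0" using \<open>T = a\<close> DT Db by (simp add: chord_def)
    finally show False using pos[of z0] below \<open>T = a\<close> by simp
  qed
  then show thesis
    using that[of T m n] T(1) DT Db pos by (simp add: D_def)
qed

text \<open>Another base \<open>z1\<close> gives a chord strictly above the tangent line at
  \<open>zB\<close>. If \<open>T <= zB\<close>, the chord from \<open>T\<close> attains the line and
  wins. Otherwise \<open>z1 < zB < T\<close>, and convexity puts the single height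
  \<open>zB\<close>, a chord degenerate at its left end, strictly below the chord from
  \<open>z1\<close>.\<close>

lemma convex_concave_upper_unique:
  fixes f :: "real \<Rightarrow> real"
  assumes T: "a < T" "T \<le> c" "c < b" "f T = m * T + n" "f b = m * b + n"
      "\<And>z. a \<le> z \<Longrightarrow> z < b \<Longrightarrow> z \<noteq> T \<Longrightarrow> m * z + n < f z"
    and cvx: "strictly_convex a c f"
    and z1: "a < z1" "z1 < zB" "zB < b"
    and opt: "\<And>x. a < x \<Longrightarrow> x \<le> zB \<Longrightarrow> chord f z1 b zB \<le> chord f x b zB"
  shows "z1 = T"
proof (rule ccontr)
  assume ne: "z1 \<noteq> T"
  define D where "D z = f z - (m * z + n)" for z
  have D0: "D T = 0" "D b = 0" using T by (simp_all add: D_def)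
  have Dopt: "chord D z1 b zB \<le> chord D x b zB" if "a < x" "x \<le> zB" for x
    unfolding D_def using opt[OF that] that z1 by (simp add: chord_affine)
  have D1: "0 < D z1" using T(6)[of z1] z1 ne by (simp add: D_def)
  have pos: "0 < chord D z1 b zB" using D1 z1 by (simp add: chord_def D0)
  show False
  proof (cases "T \<le> zB")
    case True
    then have "chord D T b zB = 0" by (simp add: chord_def D0)
    then show False using Dopt[of T] True T pos by simp
  next
    case False
    have "strictly_convex a c D" unfolding D_def by (rule strictly_convex_affine[OF cvx])
    from strictly_convexD[OF this, of z1 zB T] have *: "(T - z1) * D zB < (T - zB) * D z1"
      using z1 T False by (simp add: D0)
    have "chord D z1 b zB \<le> chord D zB b zB" using Dopt z1 by simp
    then have "(b - zB) * D z1 / (b - z1) \<le> D zB" using z1 by (simp add: chord_def D0)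
    then have "(b - zB) * D z1 \<le> (b - z1) * D zB"
      using z1 by (simp add: divide_le_eq mult.commute)
    then have "(T - z1) * ((b - zB) * D z1) \<le> (T - z1) * ((b - z1) * D zB)"
      using z1 False by (intro mult_left_mono) auto
    also have "\<dots> = (b - z1) * ((T - z1) * D zB)" by simp
    also have "\<dots> < (b - z1) * ((T - zB) * D z1)" using * z1 by (intro mult_strict_left_mono) auto
    finally have "0 < D z1 * ((b - z1) * (T - zB) - (T - z1) * (b - zB))" by (simp add: algebra_simps)
    then have "0 < (b - z1) * (T - zB) - (T - z1) * (b - zB)"
      using D1 by (simp add: zero_less_mult_iff)
    \<comment> \<open>The ratio \<open>(s - zB) / (s - z1)\<close> increases with \<open>s\<close>;
      the identity compares its values at \<open>T\<close> and at \<open>b\<close>.\<close>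
    moreover have "(b - z1) * (T - zB) - (T - z1) * (b - zB) = (zB - z1) * (T - b)"
      by (simp add: algebra_simps)
    moreover have "(zB - z1) * (T - b) \<le> 0"
      using z1 T by (intro mult_nonneg_nonpos) auto
    ultimately show False by linarith
  qed
qed

text \<open>Against chords from \<open>a\<close> to the other \<open>y >= zB\<close>, optimality
  says that \<open>f\<close> is nowhere below the line through \<open>a\<close> and
  \<open>z2\<close> on [zB, b]. If \<open>z2\<close> is on the convex piece, \<open>f\<close> dips
  below that line before \<open>z2\<close>; if it is on the concave piece, nonnegative differences
  on both sides of \<open>z2\<close> would lift \<open>f\<close> above the line at
  \<open>z2\<close>.\<close>

lemma convex_concave_no_lower:
  fixes f :: "real \<Rightarrow> real"
  assumes c: "a < c" "c < b"
    and cvx: "strictly_convex a c f" and ccv: "strictly_concave c b f"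
    and z2: "a < zB" "zB < z2" "z2 < b"
    and opt: "\<And>y. zB \<le> y \<Longrightarrow> y \<le> b \<Longrightarrow> chord f a z2 zB \<le> chord f a y zB"
  shows False
proof -
  define m where "m = (f z2 - f a) / (z2 - a)"
  define n where "n = f a - m * a"
  define D where "D z = f z - (m * z + n)" for z
  have Dcvx: "strictly_convex a c D" and Dccv: "strictly_concave c b D"
    unfolding D_def using strictly_convex_affine[OF cvx] strictly_concave_affine[OF ccv] by auto
  have Da: "D a = 0" by (simp add: D_def n_def)
  have "m * (z2 - a) = f z2 - f a" using z2 by (simp add: m_def)
  then have D2: "D z2 = 0" by (simp add: D_def n_def algebra_simps)
  have D0: "0 \<le> D y" if "zB \<le> y" "y \<le> b" for y
  proof -
    have "chord D a z2 zB \<le> chord D a y zB"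
      unfolding D_def using opt[OF that] that z2 by (simp add: chord_affine)
    then have "0 \<le> (zB - a) * D y / (y - a)" by (simp add: chord_def Da D2)
    then show ?thesis using z2 that by (simp add: zero_le_divide_iff zero_le_mult_iff)
  qed
  show False
  proof (cases "z2 \<le> c")
    case True
    from strictly_convexD[OF Dcvx, of a zB z2] have "(z2 - a) * D zB < 0"
      using True z2 by (simp add: Da D2)
    then show False using D0[of zB] z2 by (simp add: mult_less_0_iff)
  next
    case False
    have no: False if "c \<le> x" "x < z2" "0 \<le> D x" for x
    proof -
      have "(b - z2) * D x + (z2 - x) * D b < (b - x) * D z2"
        by (rule strictly_concaveD[OF Dccv]) (use that z2 in auto)
      moreover have "0 \<le> (b - z2) * D x" "0 \<le> (z2 - x) * D b" using that z2 D0[of b] by auto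
      ultimately show False by (simp add: D2)
    qed
    \<comment> \<open>So the graph is below the line at \<open>c\<close>, and convexity from the
      zero at \<open>a\<close> makes \<open>D\<close> negative at \<open>zB\<close> as well.\<close>
    have "zB < c" using no[of zB] D0[of zB] z2 by force
    moreover have "D c < 0" using no[of c] False by force
    ultimately have "(c - a) * D zB < 0"
      using strictly_convexD[OF Dcvx, of a zB c] z2 mult_pos_neg[of "zB - a" "D c"] by (simp add: Da)
    then show False using D0[of zB] z2 c by (simp add: mult_less_0_iff)
  qed
qed

section \<open>The derivative of the entropy\<close>

lemma pos_of_pos_deriv:
  fixes f :: "real \<Rightarrow> real"
  assumes "f 0 = 0" "\<And>x. (f has_real_derivative f' x) (at x)" "\<And>x. 0 < x \<Longrightarrow> 0 < f' x" "0 < y"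
  shows "0 < f y"
proof -
  have "f 0 < f y"
    by (rule DERIV_pos_imp_increasing_open[OF \<open>0 < y\<close>])
      (use assms in \<open>auto intro!: continuous_at_imp_continuous_on DERIV_isCont\<close>)
  then show ?thesis using assms(1) by simp
qed

text \<open>First rung of a ladder: each of the three differences vanishes at 0 and is the
  derivative of the next one. The last is the factor that appears in the derivative of the cube
  quotient below.\<close>

lemma sinh_less_mult_cosh:
  assumes "0 < (y::real)"
  shows "sinh y < y * cosh y"
proof -
  have "((\<lambda>y. y * cosh y - sinh y) has_real_derivative x * sinh x) (at x)" for x :: real
    by (auto intro!: derivative_eq_intros)
  from pos_of_pos_deriv[OF _ this, of y] show ?thesis using assms by simp
qed

lemma cosh_less_mult_sinh:
  assumes "0 < (y::real)"
  shows "2 * cosh y < y * sinh y + 2"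
proof -
  have "((\<lambda>y. y * sinh y + 2 - 2 * cosh y) has_real_derivative x * cosh x - sinh x) (at x)" for x :: real
    by (auto intro!: derivative_eq_intros)
  from pos_of_pos_deriv[OF _ this, of y] show ?thesis using assms sinh_less_mult_cosh by simp
qed

lemma three_sinh_less:
  assumes "0 < (y::real)"
  shows "3 * sinh y < y * cosh y + 2 * y"
proof -
  have "((\<lambda>y. y * cosh y + 2 * y - 3 * sinh y) has_real_derivative x * sinh x + 2 - 2 * cosh x) (at x)"
    for x :: real
    by (auto intro!: derivative_eq_intros)
  from pos_of_pos_deriv[OF _ this, of y] show ?thesis using assms cosh_less_mult_sinh by simp
qed

text \<open>The power series of the quotient has positive coefficients, which is why it grows; the
  proof differentiates and uses the ladder. At \<open>y = 2 * s\<close> and times -4 it is the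
  derivative of \<open>slope_sq_inv\<close>.\<close>

lemma sinh_minus_id_over_cube_strict_mono:
  assumes "0 < x" "x < (y::real)"
  shows "(sinh x - x) / x ^ 3 < (sinh y - y) / y ^ 3"
proof (rule DERIV_pos_imp_increasing[OF assms(2)])
  fix z assume "x \<le> z" "z \<le> y"
  then have z: "0 < z" using assms by simp
  let ?d = "((cosh z - 1) * z ^ 3 - (sinh z - z) * (3 * z ^ 2)) / (z ^ 3 * z ^ 3)"
  have "(cosh z - 1) * z ^ 3 - (sinh z - z) * (3 * z ^ 2) = z ^ 2 * (z * cosh z + 2 * z - 3 * sinh z)"
    by (simp add: algebra_simps power2_eq_square power3_eq_cube)
  also have "0 < \<dots>" using z three_sinh_less[OF z] by simp
  finally have "0 < ?d" using z by (intro divide_pos_pos) auto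
  moreover have "((\<lambda>z. (sinh z - z) / z ^ 3) has_real_derivative ?d) (at z)"
    using z by (auto intro!: derivative_eq_intros)
  ultimately show "\<exists>d. ((\<lambda>z. (sinh z - z) / z ^ 3) has_real_derivative d) (at z) \<and> 0 < d"
    by blast
qed

lemma tanh_artanh_real:
  assumes "\<bar>x\<bar> < (1::real)"
  shows "tanh (artanh x) = x"
proof -
  have "exp (- (2 * artanh x)) = (1 - x) / (1 + x)"
    using assms by (simp add: artanh_def exp_minus)
  moreover have "1 + (1 - x) / (1 + x) = 2 / (1 + x)" "1 - (1 - x) / (1 + x) = 2 * x / (1 + x)"
    using assms by (simp_all add: field_simps)
  ultimately show ?thesis using assms by (simp add: tanh_real_altdef)
qed

lemma artanh_pos: "0 < x \<Longrightarrow> x < 1 \<Longrightarrow> 0 < artanh (x::real)"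
  by (simp add: artanh_def)

lemma artanh_strict_mono:
  assumes "0 < x" "x < y" "y < (1::real)"
  shows "artanh x < artanh y"
proof -
  have "(1 + x) / (1 - x) < (1 + y) / (1 - y)" using assms by (simp add: frac_less)
  then show ?thesis using assms by (simp add: artanh_def)
qed

text \<open>Along the parabola \<open>w = M - k * t\<^sup>2\<close>, the squared slope of the entropy is a constant times
  \<open>t\<^sup>2 / slope_sq_inv w\<close>; the derivative of this quotient has the sign of \<open>curv_sign M w\<close>.\<close>
definition slope_sq_inv :: "real \<Rightarrow> real" where
  "slope_sq_inv w = w / (artanh (sqrt w))\<^sup>2"

definition slope_sq_inv' :: "real \<Rightarrow> real" where
  "slope_sq_inv' w = (2 * artanh (sqrt w) - sinh (2 * artanh (sqrt w))) / (2 * artanh (sqrt w) ^ 3)"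

lemma slope_sq_inv_pos: "0 < w \<Longrightarrow> w < 1 \<Longrightarrow> 0 < slope_sq_inv w"
  using artanh_pos[of "sqrt w"] by (simp add: slope_sq_inv_def)

text \<open>Differentiating \<open>artanh (sqrt w)\<close> produces \<open>sqrt w / (1 - w)\<close>;
  expressed through \<open>s = artanh (sqrt w)\<close>, it leaves a derivative of
  \<open>slope_sq_inv\<close> that depends on \<open>s\<close> alone.\<close>

lemma sinh_double_artanh_sqrt:
  assumes "0 < w" "w < 1"
  shows "sinh (2 * artanh (sqrt w)) = 2 * (sqrt w / (1 - w))"
proof -
  define s where "s = artanh (sqrt w)"
  have t: "tanh s = sqrt w" unfolding s_def using assms by (intro tanh_artanh_real) simp
  have "(cosh s)\<^sup>2 - (sinh s)\<^sup>2 = 1" by (simp add: cosh_square_eq)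
  moreover have sc: "sinh s = sqrt w * cosh s"
    using t cosh_real_pos[of s] by (simp add: tanh_def field_simps)
  ultimately have "(cosh s)\<^sup>2 * (1 - w) = 1" using assms by (simp add: power_mult_distrib algebra_simps)
  then have "(cosh s)\<^sup>2 = 1 / (1 - w)" using assms by (simp add: field_simps)
  moreover have "sinh (2 * s) = 2 * sqrt w * (cosh s)\<^sup>2"
    by (simp add: sinh_double sc power2_eq_square)
  ultimately show ?thesis by (simp add: s_def)
qed

lemma slope_sq_inv_deriv:
  assumes "0 < w" "w < 1"
  shows "(slope_sq_inv has_real_derivative slope_sq_inv' w) (at w)"
proof -
  define s where "s = artanh (sqrt w)"
  have s: "0 < s" unfolding s_def using assms by (intro artanh_pos) auto
  have d: "(slope_sq_inv has_real_derivative
      (s\<^sup>2 - w * (2 * s * (1 / (1 - (sqrt w)\<^sup>2) * (inverse (sqrt w) / 2)))) / (s\<^sup>2 * s\<^sup>2)) (at w)"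
    unfolding slope_sq_inv_def
    using assms s
    by (auto intro!: derivative_eq_intros artanh_real_has_field_derivative[THEN DERIV_chain2]
        simp: s_def)
  have "w * inverse (sqrt w) = sqrt w"
    using assms by (metis divide_inverse order_less_le real_div_sqrt)
  moreover have "w * (2 * s * (1 / (1 - (sqrt w)\<^sup>2) * (inverse (sqrt w) / 2)))
      = s * (w * inverse (sqrt w) / (1 - w))"
    using assms by (simp add: divide_simps)
  moreover have "sqrt w / (1 - w) = sinh (2 * s) / 2"
    unfolding s_def sinh_double_artanh_sqrt[OF assms]
    by (rule nonzero_mult_div_cancel_left[symmetric]) simp
  ultimately have e: "w * (2 * s * (1 / (1 - (sqrt w)\<^sup>2) * (inverse (sqrt w) / 2))) = s * (sinh (2 * s) / 2)"
    by (simp only:)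
  have "(s\<^sup>2 - s * (sinh (2 * s) / 2)) / (s\<^sup>2 * s\<^sup>2) = slope_sq_inv' w"
    using s by (simp add: slope_sq_inv'_def s_def[symmetric] field_simps power2_eq_square power3_eq_cube)
  then show ?thesis using d unfolding e by (simp only:)
qed

text \<open>This is the strict concavity of \<open>slope_sq_inv\<close>, inherited from the cube
  quotient since \<open>artanh (sqrt w)\<close> grows with \<open>w\<close>.\<close>

lemma slope_sq_inv'_strict_antimono:
  assumes "0 < w1" "w1 < w2" "w2 < 1"
  shows "slope_sq_inv' w2 < slope_sq_inv' w1"
proof -
  define F where "F y = (sinh y - y) / y ^ 3" for y :: real
  have e: "slope_sq_inv' w = - 4 * F (2 * artanh (sqrt w))" if "0 < w" "w < 1" for w
    using artanh_pos[of "sqrt w"] that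
    by (simp add: slope_sq_inv'_def F_def field_simps power3_eq_cube)
  have "artanh (sqrt w1) < artanh (sqrt w2)" "0 < artanh (sqrt w1)"
    using assms by (auto intro!: artanh_strict_mono artanh_pos)
  then show ?thesis
    using assms e sinh_minus_id_over_cube_strict_mono[of "2 * artanh (sqrt w1)" "2 * artanh (sqrt w2)",
        folded F_def]
    by simp
qed

definition curv_sign :: "real \<Rightarrow> real \<Rightarrow> real" where
  "curv_sign M w = slope_sq_inv w + (M - w) * slope_sq_inv' w"

text \<open>The concavity of \<open>slope_sq_inv\<close> makes its tangent at \<open>w\<close>, evaluated at \<open>M\<close>, decrease in \<open>w\<close>.\<close>
lemma curv_sign_strict_antimono:
  assumes "0 < w1" "w1 < w2" "w2 < 1" "w2 < M"
  shows "curv_sign M w2 < curv_sign M w1"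
proof -
  obtain \<xi> where x: "w1 < \<xi>" "\<xi> < w2"
    and d: "slope_sq_inv w2 - slope_sq_inv w1 = (w2 - w1) * slope_sq_inv' \<xi>"
    using MVT2[OF assms(2), of slope_sq_inv slope_sq_inv'] slope_sq_inv_deriv assms by force
  have "slope_sq_inv' \<xi> < slope_sq_inv' w1"
    using slope_sq_inv'_strict_antimono[of w1 \<xi>] assms x by simp
  then have "(w2 - w1) * slope_sq_inv' \<xi> < (w2 - w1) * slope_sq_inv' w1"
    using assms by simp
  moreover have "(M - w2) * slope_sq_inv' w2 < (M - w2) * slope_sq_inv' w1"
    using slope_sq_inv'_strict_antimono[OF assms(1-3)] assms by simp
  ultimately show ?thesis using d by (simp add: curv_sign_def algebra_simps)
qed

text \<open>The derivative of \<open>slope_sq_inv\<close> is negative, so \<open>M = 1\<close> is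
  the extremal case, and there \<open>s ^ 3 * curv_sign 1 w\<close> collapses to
  \<open>s - sqrt w\<close>, which is \<open>s - tanh s\<close>.\<close>

lemma curv_sign_pos:
  assumes "0 < w" "w < 1" "M \<le> 1"
  shows "0 < curv_sign M w"
proof -
  define s where "s = artanh (sqrt w)"
  have s: "0 < s" unfolding s_def using assms by (intro artanh_pos) auto
  have t: "tanh s = sqrt w" unfolding s_def using assms by (intro tanh_artanh_real) simp
  have "sinh s < s * cosh s" by (rule sinh_less_mult_cosh[OF s])
  then have "sqrt w < s" using t cosh_real_pos[of s] by (simp add: tanh_def field_simps)
  have sh: "sinh (2 * s) = 2 * (sqrt w / (1 - w))"
    using sinh_double_artanh_sqrt[OF assms(1,2)] by (simp add: s_def)
  have neg: "slope_sq_inv' w < 0"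
  proof -
    have d: "((\<lambda>y. sinh y - y) has_real_derivative cosh x - 1) (at x)" for x :: real
      by (auto intro!: derivative_eq_intros)
    have "0 < sinh (2 * s) - 2 * s"
      using pos_of_pos_deriv[OF _ d, of "2 * s"] s by (simp add: cosh_real_strict_mono[of 0, simplified])
    then show ?thesis using s by (simp add: slope_sq_inv'_def s_def[symmetric] divide_less_0_iff)
  qed
  have "0 < w * s + (1 - w) * s - sqrt w" using \<open>sqrt w < s\<close> by (simp add: algebra_simps)
  also have "\<dots> = s ^ 3 * (w / s\<^sup>2) + (1 - w) * (2 * s - sinh (2 * s)) / 2"
    unfolding sh right_diff_distrib using s assms by (simp add: power2_eq_square power3_eq_cube)
  also have "\<dots> = s ^ 3 * (w / s\<^sup>2 + (1 - w) * ((2 * s - sinh (2 * s)) / (2 * s ^ 3)))"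
    unfolding distrib_left using s by simp
  finally have "0 < curv_sign 1 w"
    using s by (simp add: zero_less_mult_iff curv_sign_def slope_sq_inv_def slope_sq_inv'_def s_def[symmetric])
  also have "curv_sign 1 w \<le> curv_sign M w"
    unfolding curv_sign_def using neg assms by (simp add: mult_right_mono_neg)
  finally show ?thesis .
qed

section \<open>Derivative, continuity and monotonicity of the binary entropy\<close>

lemma mult_ln_deriv:
  assumes "0 < (y::real)"
  shows "((\<lambda>y. y * ln y) has_real_derivative ln y + 1) (at y)"
proof -
  have "((\<lambda>y. y * ln y) has_real_derivative 1 * ln y + 1 / y * y) (at y)"
    by (rule DERIV_mult[OF DERIV_ident DERIV_ln_divide[OF assms]])
  then show ?thesis using assms by simp
qed

lemma bin_entropy_deriv:
  assumes "0 < x" "x < 1"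
  shows "(bin_entropy has_real_derivative (- artanh x / ln 2)) (at x)"
proof -
  define p q where "p = ln ((1 + x) / 2)" and "q = ln ((1 - x) / 2)"
  have "- artanh x = - ((p + 1) * (1 / 2)) - (q + 1) * (- 1 / 2)"
    using assms by (simp add: artanh_def ln_div p_def q_def field_simps)
  then have e: "- artanh x / ln 2 = - ((ln ((1 + x) / 2) + 1) * (1 / 2)) / ln 2
      - ((ln ((1 - x) / 2) + 1) * (- 1 / 2)) / ln 2"
    unfolding p_def q_def by (simp only: diff_divide_distrib)
  have "((\<lambda>x. (1 + x) / 2 * ln ((1 + x) / 2)) has_real_derivative (ln ((1 + x) / 2) + 1) * (1 / 2)) (at x)"
  proof (rule DERIV_chain2[OF mult_ln_deriv])
    show "((\<lambda>x. (1 + x) / 2) has_real_derivative 1 / 2) (at x)"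
      by (intro derivative_eq_intros refl) auto
  qed (use assms in simp)
  moreover have "((\<lambda>x. (1 - x) / 2 * ln ((1 - x) / 2)) has_real_derivative
      (ln ((1 - x) / 2) + 1) * (- 1 / 2)) (at x)"
  proof (rule DERIV_chain2[OF mult_ln_deriv])
    show "((\<lambda>x. (1 - x) / 2) has_real_derivative - 1 / 2) (at x)"
      by (intro derivative_eq_intros refl) auto
  qed (use assms in simp)
  ultimately have "((\<lambda>x. - ((1 + x) / 2 * ln ((1 + x) / 2)) / ln 2 - (1 - x) / 2 * ln ((1 - x) / 2) / ln 2)
      has_real_derivative - artanh x / ln 2) (at x)"
    unfolding e by (intro DERIV_diff DERIV_cdivide DERIV_minus)
  then show ?thesis by (simp add: bin_entropy_def[abs_def] log_def)
qed

text \<open>Continuity at 0 is what makes the entropy continuous at radius 1, where its slope is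
  infinite.\<close>

lemma continuous_on_mult_ln: "continuous_on {0..} (\<lambda>x::real. x * ln x)"
proof -
  have "((\<lambda>x::real. x * ln x) \<longlongrightarrow> 0) (at 0 within {0..})"
  proof -
    have "((\<lambda>x::real. x * ln x) \<longlongrightarrow> 0) (at_right 0)" by real_asymp
    then show ?thesis by (simp add: at_within_Ici_at_right)
  qed
  moreover have "((\<lambda>x::real. x * ln x) \<longlongrightarrow> y * ln y) (at y within {0..})" if "0 < y" for y
    by (intro tendsto_intros) (use that in auto)
  ultimately show ?thesis
    unfolding continuous_on_def by (metis atLeast_iff le_less mult_zero_left)
qed

lemma continuous_on_bin_entropy: "continuous_on {0..1} bin_entropy"
proof -
  have 1: "continuous_on {0..1} (\<lambda>x::real. (1 + x) / 2 * ln ((1 + x) / 2))"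
    by (rule continuous_on_compose2[OF continuous_on_mult_ln]) (auto intro!: continuous_intros)
  have 2: "continuous_on {0..1} (\<lambda>x::real. (1 - x) / 2 * ln ((1 - x) / 2))"
    by (rule continuous_on_compose2[OF continuous_on_mult_ln]) (auto intro!: continuous_intros)
  have "continuous_on {0..1} (\<lambda>x::real. - ((1 + x) / 2 * ln ((1 + x) / 2)) / ln 2
      - (1 - x) / 2 * ln ((1 - x) / 2) / ln 2)"
    by (intro continuous_on_diff continuous_on_divide continuous_on_minus 1 2 continuous_on_const) auto
  then show ?thesis by (simp add: bin_entropy_def[abs_def] log_def)
qed

lemma bin_entropy_strict_antimono:
  assumes "0 \<le> x" "x < y" "y \<le> 1"
  shows "bin_entropy y < bin_entropy x"
proof (rule DERIV_neg_imp_decreasing_open[OF assms(2)])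
  fix z assume "x < z" "z < y"
  then have "0 < z" "z < 1" using assms by auto
  then show "\<exists>d. (bin_entropy has_real_derivative d) (at z) \<and> d < 0"
    using bin_entropy_deriv artanh_pos by (intro exI[of _ "- artanh z / ln 2"]) auto
next
  show "continuous_on {x..y} bin_entropy"
    by (rule continuous_on_subset[OF continuous_on_bin_entropy]) (use assms in auto)
qed

lemma bin_entropy_antimono:
  "0 \<le> x \<Longrightarrow> x \<le> y \<Longrightarrow> y \<le> 1 \<Longrightarrow> bin_entropy y \<le> bin_entropy x"
  using bin_entropy_strict_antimono[of x y] by (cases "x = y") auto

section \<open>Entropy along a parabola\<close>

text \<open>The switch is the supremum of the points where \<open>j\<close> is not positive. The
  sign at the switch itself stays open, as curvature is examined only inside the two pieces.\<close>

lemma strict_mono_sign_cases: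
  fixes j :: "real \<Rightarrow> real"
  assumes "a < b" and mono: "strict_mono_on {a<..<b} j"
  obtains "\<forall>x. a < x \<and> x < b \<longrightarrow> 0 < j x"
  | "\<forall>x. a < x \<and> x < b \<longrightarrow> j x < 0"
  | c where "a < c" "c < b" "\<And>x. a < x \<Longrightarrow> x < c \<Longrightarrow> j x < 0" "\<And>x. c < x \<Longrightarrow> x < b \<Longrightarrow> 0 < j x"
proof (cases "(\<forall>x. a < x \<and> x < b \<longrightarrow> 0 < j x) \<or> (\<forall>x. a < x \<and> x < b \<longrightarrow> j x < 0)")
  case True
  then show thesis using that(1,2) by blast
next
  case False
  then obtain p q where p: "a < p" "p < b" "j p \<le> 0" and q: "a < q" "q < b" "0 \<le> j q"
    by (auto simp: not_less)
  define S where "S = {x. a < x \<and> x < b \<and> j x \<le> 0}"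
  have Sq: "x \<le> q" if "x \<in> S" for x
    using strict_mono_onD[OF mono, of q x] q that by (force simp: S_def not_le[symmetric])
  then have bdd: "bdd_above S" by (auto simp: bdd_above_def)
  have "p \<in> S" using p by (simp add: S_def)
  show thesis
  proof (rule that(3)[of "Sup S"])
    show "a < Sup S" using cSup_upper[OF \<open>p \<in> S\<close> bdd] p by simp
    have "Sup S \<le> q" using Sq \<open>p \<in> S\<close> by (intro cSup_least) auto
    then show "Sup S < b" using q by simp
    show "j x < 0" if x: "a < x" "x < Sup S" for x
    proof -
      obtain y where "y \<in> S" "x < y" using x less_cSup_iff[OF _ bdd] \<open>p \<in> S\<close> by blast
      then show ?thesis using strict_mono_onD[OF mono, of x y] x by (force simp: S_def)
    qed
    show "0 < j x" if x: "Sup S < x" "x < b" for x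
    proof (rule ccontr)
      assume "\<not> 0 < j x"
      then have "x \<in> S" using x \<open>a < Sup S\<close> by (simp add: S_def)
      then show False using cSup_upper[OF _ bdd] x by force
    qed
  qed
qed

text \<open>Here \<open>t\<close> is the distance of a height from the axis of the parabola, so only
  \<open>t >= 0\<close> matters in what follows.\<close>

definition entropy_profile :: "real \<Rightarrow> real \<Rightarrow> real \<Rightarrow> real" where
  "entropy_profile M k t = bin_entropy (sqrt (M - k * t\<^sup>2))"

definition profile_slope :: "real \<Rightarrow> real \<Rightarrow> real \<Rightarrow> real" where
  "profile_slope M k t = t * (artanh (sqrt (M - k * t\<^sup>2)) / sqrt (M - k * t\<^sup>2))"

lemma entropy_profile_deriv:
  assumes "0 < M - k * t\<^sup>2" "M - k * t\<^sup>2 < 1"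
  shows "(entropy_profile M k has_real_derivative k / ln 2 * profile_slope M k t) (at t)"
proof -
  let ?w = "M - k * t\<^sup>2"
  have "((\<lambda>t. M - k * t\<^sup>2) has_real_derivative - (2 * k * t)) (at t)"
    by (auto intro!: derivative_eq_intros)
  then have "((\<lambda>t. sqrt (M - k * t\<^sup>2)) has_real_derivative inverse (sqrt ?w) / 2 * (- (2 * k * t))) (at t)"
    by (rule DERIV_chain2[OF DERIV_real_sqrt, rotated]) (use assms in auto)
  then have "((\<lambda>t. bin_entropy (sqrt (M - k * t\<^sup>2))) has_real_derivative
      - artanh (sqrt ?w) / ln 2 * (inverse (sqrt ?w) / 2 * (- (2 * k * t)))) (at t)"
    by (rule DERIV_chain2[OF bin_entropy_deriv, rotated 2]) (use assms in auto)
  moreover have "- artanh (sqrt ?w) / ln 2 * (inverse (sqrt ?w) / 2 * (- (2 * k * t)))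
      = k / ln 2 * profile_slope M k t"
  proof -
    have "- p / l * (inverse q / 2 * (- (2 * k * t))) = k / l * (t * (p / q))" for p l q :: real
      by (simp add: divide_simps)
    then show ?thesis unfolding profile_slope_def .
  qed
  ultimately show ?thesis by (simp only: entropy_profile_def[abs_def])
qed

lemma profile_slope_sq:
  assumes "0 < M - k * t\<^sup>2" "M - k * t\<^sup>2 < 1"
  shows "(profile_slope M k t)\<^sup>2 = t\<^sup>2 / slope_sq_inv (M - k * t\<^sup>2)"
  using assms by (simp add: profile_slope_def slope_sq_inv_def power_mult_distrib power_divide)

lemma profile_slope_sq_deriv:
  assumes "0 < M - k * t\<^sup>2" "M - k * t\<^sup>2 < 1"
  shows "((\<lambda>t. t\<^sup>2 / slope_sq_inv (M - k * t\<^sup>2)) has_real_derivative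
    2 * t * curv_sign M (M - k * t\<^sup>2) / (slope_sq_inv (M - k * t\<^sup>2))\<^sup>2) (at t)"
proof -
  let ?w = "M - k * t\<^sup>2"
  have "((\<lambda>t. M - k * t\<^sup>2) has_real_derivative - (2 * k * t)) (at t)"
    by (auto intro!: derivative_eq_intros)
  then have "((\<lambda>t. slope_sq_inv (M - k * t\<^sup>2)) has_real_derivative slope_sq_inv' ?w * (- (2 * k * t))) (at t)"
    by (rule DERIV_chain2[OF slope_sq_inv_deriv, rotated 2]) (use assms in auto)
  moreover have "((\<lambda>t. t\<^sup>2) has_real_derivative 2 * t) (at t)"
    by (auto intro!: derivative_eq_intros)
  ultimately have "((\<lambda>t. t\<^sup>2 / slope_sq_inv (M - k * t\<^sup>2)) has_real_derivative
     (2 * t * slope_sq_inv ?w - t\<^sup>2 * (slope_sq_inv' ?w * (- (2 * k * t)))) / (slope_sq_inv ?w * slope_sq_inv ?w)) (at t)"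
    using slope_sq_inv_pos[OF assms] by (intro DERIV_divide) auto
  moreover have "2 * t * slope_sq_inv ?w - t\<^sup>2 * (slope_sq_inv' ?w * (- (2 * k * t))) = 2 * t * curv_sign M ?w"
    by (simp add: curv_sign_def algebra_simps power2_eq_square)
  ultimately show ?thesis by (simp only: power2_eq_square)
qed

text \<open>The squares are compared, since their derivative has the sign of
  \<open>curv_sign\<close>; the inequality survives taking roots because the larger slope is
  nonnegative.\<close>

lemma profile_slope_strict_mono:
  assumes "0 < x" "x < y"
    and w: "\<And>t. x \<le> t \<Longrightarrow> t \<le> y \<Longrightarrow> 0 < M - k * t\<^sup>2 \<and> M - k * t\<^sup>2 < 1 \<and> 0 < curv_sign M (M - k * t\<^sup>2)"
  shows "profile_slope M k x < profile_slope M k y"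
proof -
  have "x\<^sup>2 / slope_sq_inv (M - k * x\<^sup>2) < y\<^sup>2 / slope_sq_inv (M - k * y\<^sup>2)"
  proof (rule DERIV_pos_imp_increasing[OF assms(2)])
    fix t assume t: "x \<le> t" "t \<le> y"
    have "0 < 2 * t * curv_sign M (M - k * t\<^sup>2) / (slope_sq_inv (M - k * t\<^sup>2))\<^sup>2"
      using w[OF t] t assms(1) slope_sq_inv_pos[of "M - k * t\<^sup>2"] by simp
    then show "\<exists>d. ((\<lambda>t. t\<^sup>2 / slope_sq_inv (M - k * t\<^sup>2)) has_real_derivative d) (at t) \<and> 0 < d"
      using profile_slope_sq_deriv w[OF t] by blast
  qed
  then have "(profile_slope M k x)\<^sup>2 < (profile_slope M k y)\<^sup>2"
    using w[of x] w[of y] assms by (simp add: profile_slope_sq)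
  moreover have "0 \<le> profile_slope M k y"
    unfolding profile_slope_def
    by (intro mult_nonneg_nonneg divide_nonneg_nonneg order.strict_implies_order[OF artanh_pos])
      (use w[of y] assms in \<open>simp_all add: less_imp_le\<close>)
  ultimately show ?thesis by (rule power2_less_imp_less)
qed

lemma profile_slope_strict_antimono:
  assumes "0 < x" "x < y"
    and w: "\<And>t. x \<le> t \<Longrightarrow> t \<le> y \<Longrightarrow> 0 < M - k * t\<^sup>2 \<and> M - k * t\<^sup>2 < 1 \<and> curv_sign M (M - k * t\<^sup>2) < 0"
  shows "profile_slope M k y < profile_slope M k x"
proof -
  have "y\<^sup>2 / slope_sq_inv (M - k * y\<^sup>2) < x\<^sup>2 / slope_sq_inv (M - k * x\<^sup>2)"
  proof (rule DERIV_neg_imp_decreasing[OF assms(2)])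
    fix t assume t: "x \<le> t" "t \<le> y"
    have "2 * t * curv_sign M (M - k * t\<^sup>2) / (slope_sq_inv (M - k * t\<^sup>2))\<^sup>2 < 0"
      using w[OF t] t assms(1) slope_sq_inv_pos[of "M - k * t\<^sup>2"]
      by (simp add: divide_less_0_iff mult_pos_neg)
    then show "\<exists>d. ((\<lambda>t. t\<^sup>2 / slope_sq_inv (M - k * t\<^sup>2)) has_real_derivative d) (at t) \<and> d < 0"
      using profile_slope_sq_deriv w[OF t] by blast
  qed
  then have "(profile_slope M k y)\<^sup>2 < (profile_slope M k x)\<^sup>2"
    using w[of x] w[of y] assms by (simp add: profile_slope_sq)
  moreover have "0 \<le> profile_slope M k x"
    unfolding profile_slope_def
    by (intro mult_nonneg_nonneg divide_nonneg_nonneg order.strict_implies_order[OF artanh_pos])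
      (use w[of x] assms in \<open>simp_all add: less_imp_le\<close>)
  ultimately show ?thesis by (rule power2_less_imp_less)
qed

lemma continuous_on_entropy_profile:
  assumes "\<And>t. t \<in> S \<Longrightarrow> 0 \<le> M - k * t\<^sup>2 \<and> M - k * t\<^sup>2 \<le> 1"
  shows "continuous_on S (entropy_profile M k)"
  unfolding entropy_profile_def
  by (rule continuous_on_compose2[OF continuous_on_bin_entropy])
    (use assms in \<open>auto intro!: continuous_intros\<close>)

lemma entropy_profile_strictly_convex:
  assumes k: "0 < k" and t: "0 \<le> a"
    and cont: "continuous_on {a..b} (entropy_profile M k)"
    and w: "\<And>t. a < t \<Longrightarrow> t < b \<Longrightarrow> 0 < M - k * t\<^sup>2 \<and> M - k * t\<^sup>2 < 1 \<and> 0 < curv_sign M (M - k * t\<^sup>2)"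
  shows "strictly_convex a b (entropy_profile M k)"
proof (rule strictly_convex_deriv[OF cont])
  show "(entropy_profile M k has_real_derivative k / ln 2 * profile_slope M k x) (at x)"
    if "a < x" "x < b" for x
    using w[OF that] by (intro entropy_profile_deriv) auto
  show "k / ln 2 * profile_slope M k x < k / ln 2 * profile_slope M k y"
    if "a < x" "x < y" "y < b" for x y
    using k profile_slope_strict_mono[of x y M k] w that t by (intro mult_strict_left_mono) auto
qed

lemma entropy_profile_strictly_concave:
  assumes k: "0 < k" and t: "0 \<le> a"
    and cont: "continuous_on {a..b} (entropy_profile M k)"
    and w: "\<And>t. a < t \<Longrightarrow> t < b \<Longrightarrow> 0 < M - k * t\<^sup>2 \<and> M - k * t\<^sup>2 < 1 \<and> curv_sign M (M - k * t\<^sup>2) < 0"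
  shows "strictly_concave a b (entropy_profile M k)"
  unfolding strictly_concave_def
proof (rule strictly_convex_deriv)
  show "continuous_on {a..b} (\<lambda>x. - entropy_profile M k x)" using cont by (rule continuous_on_minus)
  show "((\<lambda>x. - entropy_profile M k x) has_real_derivative - (k / ln 2 * profile_slope M k x)) (at x)"
    if "a < x" "x < b" for x
    using w[OF that] by (intro DERIV_minus entropy_profile_deriv) auto
  show "- (k / ln 2 * profile_slope M k x) < - (k / ln 2 * profile_slope M k y)"
    if "a < x" "x < y" "y < b" for x y
    unfolding neg_less_iff_less
    using k profile_slope_strict_antimono[of x y M k] w that t by (intro mult_strict_left_mono) auto
qed

text \<open>The squared radius strictly decreases for \<open>t >= 0\<close>, so the values 0 and 1,
  where the slope formula fails, can occur only at the end points.\<close>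

lemma profile_interior:
  fixes k M :: real
  assumes "0 < k" "0 \<le> a" "a < t" "t < b" "0 \<le> M - k * b\<^sup>2" "M - k * a\<^sup>2 \<le> 1"
  shows "0 < M - k * t\<^sup>2" "M - k * t\<^sup>2 < 1"
proof -
  have "a\<^sup>2 < t\<^sup>2" "t\<^sup>2 < b\<^sup>2" using assms by (auto intro!: power_strict_mono)
  then have "k * a\<^sup>2 < k * t\<^sup>2" "k * t\<^sup>2 < k * b\<^sup>2" using assms by simp_all
  then show "0 < M - k * t\<^sup>2" "M - k * t\<^sup>2 < 1" using assms by linarith+
qed

lemma entropy_profile_convex_small:
  assumes k: "0 < k" and t: "0 \<le> a" and M: "M \<le> 1"
    and w: "0 \<le> M - k * b\<^sup>2" "M - k * a\<^sup>2 \<le> 1"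
    and cont: "continuous_on {a..b} (entropy_profile M k)"
  shows "strictly_convex a b (entropy_profile M k)"
  using k t cont
proof (rule entropy_profile_strictly_convex)
  fix s assume "a < s" "s < b"
  from profile_interior[OF k t this w]
  show "0 < M - k * s\<^sup>2 \<and> M - k * s\<^sup>2 < 1 \<and> 0 < curv_sign M (M - k * s\<^sup>2)"
    using curv_sign_pos M by blast
qed

text \<open>As \<open>t\<close> grows, the squared radius falls and \<open>curv_sign\<close> rises,
  so its sign can change only from negative to positive: any concave piece is the one nearer to the
  axis.\<close>

lemma entropy_profile_shape:
  assumes k: "0 < k" and t: "0 \<le> a" "a < b"
    and w: "0 \<le> M - k * b\<^sup>2" "M - k * a\<^sup>2 \<le> 1"
    and cont: "continuous_on {a..b} (entropy_profile M k)"
  obtains "strictly_convex a b (entropy_profile M k)"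
  | "strictly_concave a b (entropy_profile M k)"
  | c where "a < c" "c < b" "strictly_concave a c (entropy_profile M k)"
      "strictly_convex c b (entropy_profile M k)"
proof -
  note int = profile_interior[OF k t(1) _ _ w]
  have mono: "curv_sign M (M - k * x\<^sup>2) < curv_sign M (M - k * y\<^sup>2)" if "a < x" "x < y" "y < b" for x y
  proof (rule curv_sign_strict_antimono)
    have "x\<^sup>2 < y\<^sup>2" using that t by (intro power_strict_mono) auto
    then show "M - k * y\<^sup>2 < M - k * x\<^sup>2" using k by simp
    show "M - k * x\<^sup>2 < M" using k that t by simp
  qed (use int that in auto)
  then have "strict_mono_on {a<..<b} (\<lambda>t. curv_sign M (M - k * t\<^sup>2))"
    by (auto intro: strict_mono_onI)
  with t(2) show thesis
  proof (cases rule: strict_mono_sign_cases)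
    case 1
    show thesis
    proof (rule that(1), rule entropy_profile_strictly_convex[OF k t(1) cont])
      fix s assume s: "a < s" "s < b"
      show "0 < M - k * s\<^sup>2 \<and> M - k * s\<^sup>2 < 1 \<and> 0 < curv_sign M (M - k * s\<^sup>2)"
        using int[OF s] 1 s by blast
    qed
  next
    case 2
    show thesis
    proof (rule that(2), rule entropy_profile_strictly_concave[OF k t(1) cont])
      fix s assume s: "a < s" "s < b"
      show "0 < M - k * s\<^sup>2 \<and> M - k * s\<^sup>2 < 1 \<and> curv_sign M (M - k * s\<^sup>2) < 0"
        using int[OF s] 2 s by blast
    qed
  next
    case (3 c)
    have "strictly_concave a c (entropy_profile M k)"
      using 3 int by (intro entropy_profile_strictly_concave k t continuous_on_subset[OF cont]) auto
    moreover have "strictly_convex c b (entropy_profile M k)"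
      using 3 int t by (intro entropy_profile_strictly_convex k continuous_on_subset[OF cont]) auto
    ultimately show thesis using that(3) 3 by blast
  qed
qed

section \<open>Entropy as a function of the squared radius\<close>

lemma bin_entropy_sqrt_deriv:
  assumes "0 < w" "w < 1"
  shows "((\<lambda>w. bin_entropy (sqrt w)) has_real_derivative - (artanh (sqrt w) / sqrt w) / (2 * ln 2)) (at w)"
proof -
  have "((\<lambda>w. bin_entropy (sqrt w)) has_real_derivative - artanh (sqrt w) / ln 2 * (inverse (sqrt w) / 2)) (at w)"
    by (rule DERIV_chain2[OF bin_entropy_deriv DERIV_real_sqrt]) (use assms in auto)
  moreover have "- artanh (sqrt w) / ln 2 * (inverse (sqrt w) / 2) = - (artanh (sqrt w) / sqrt w) / (2 * ln 2)"
  proof -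
    have "- p / l * (inverse q / 2) = - (p / q) / (2 * l)" for p l q :: real
      by (simp add: divide_simps)
    then show ?thesis .
  qed
  ultimately show ?thesis by (simp only:)
qed

text \<open>The derivative has the sign of \<open>z / (1 - z\<^sup>2) - s\<close> with
  \<open>s = artanh z\<close>, which equals \<open>sinh (2 * s) / 2 - s\<close>.\<close>

lemma artanh_div_strict_mono:
  assumes "0 < x" "x < y" "y < (1::real)"
  shows "artanh x / x < artanh y / y"
proof (rule DERIV_pos_imp_increasing[OF assms(2)])
  fix z assume "x \<le> z" "z \<le> y"
  then have z: "0 < z" "z < 1" using assms by auto
  define s where "s = artanh z"
  have s: "0 < s" unfolding s_def by (rule artanh_pos[OF z])
  have th: "tanh s = z" unfolding s_def by (rule tanh_artanh_real) (use z in simp)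
  have "z\<^sup>2 < 1" using z by (simp add: power_less_one_iff)
  have sh: "sinh (2 * s) = 2 * (z / (1 - z\<^sup>2))"
    using sinh_double_artanh_sqrt[of "z\<^sup>2"] z \<open>z\<^sup>2 < 1\<close> by (simp add: s_def)
  have d: "((\<lambda>y. sinh y - y) has_real_derivative cosh x - 1) (at x)" for x :: real
    by (auto intro!: derivative_eq_intros)
  have "0 < sinh (2 * s) - 2 * s"
    using pos_of_pos_deriv[OF _ d, of "2 * s"] s by (simp add: cosh_real_strict_mono[of 0, simplified])
  then have "0 < (1 / (1 - z\<^sup>2) * z - s * 1) / (z * z)" unfolding sh using z by simp
  moreover have "((\<lambda>z. artanh z / z) has_real_derivative (1 / (1 - z\<^sup>2) * z - s * 1) / (z * z)) (at z)"
    unfolding s_def using z by (intro DERIV_divide artanh_real_has_field_derivative DERIV_ident) auto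
  ultimately show "\<exists>d. ((\<lambda>z. artanh z / z) has_real_derivative d) (at z) \<and> 0 < d" by blast
qed

text \<open>The slope is a negative multiple of \<open>artanh r / r\<close> with
  \<open>r = sqrt w\<close>. Being decreasing as well, the function turns a convex squared radius
  into a concave entropy.\<close>

lemma bin_entropy_sqrt_concave: "concave_on {0..1} (\<lambda>w. bin_entropy (sqrt w))"
proof (rule strictly_concave_imp_concave_on)
  have "continuous_on {0..1} (\<lambda>w. bin_entropy (sqrt w))"
    by (rule continuous_on_compose2[OF continuous_on_bin_entropy]) (auto intro!: continuous_intros)
  then show "strictly_concave 0 1 (\<lambda>w. bin_entropy (sqrt w))"
    unfolding strictly_concave_def
  proof (intro strictly_convex_deriv[OF continuous_on_minus DERIV_minus[OF bin_entropy_sqrt_deriv]])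
    fix x y :: real assume "0 < x" "x < y" "y < 1"
    then have "artanh (sqrt x) / sqrt x < artanh (sqrt y) / sqrt y"
      by (intro artanh_div_strict_mono) auto
    then show "- (- (artanh (sqrt x) / sqrt x) / (2 * ln 2)) < - (- (artanh (sqrt y) / sqrt y) / (2 * ln 2))"
      unfolding minus_divide_left[symmetric] minus_minus by (rule divide_strict_right_mono) simp
  qed
qed

section \<open>Convex envelopes and the horizontal average entropy\<close>

text \<open>The heights \<open>x'\<close> and \<open>y'\<close> may equal \<open>z\<close>, so the
  comparison includes the value \<open>f z\<close> itself; \<open>x' < y'\<close> keeps the
  denominator of \<open>chord\<close> positive.\<close>

definition chord_optimal :: "(real \<Rightarrow> real) \<Rightarrow> real \<Rightarrow> real \<Rightarrow> real \<Rightarrow> real \<Rightarrow> real \<Rightarrow> bool" where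
  "chord_optimal f a b x y z \<longleftrightarrow>
     (\<forall>x' y'. a \<le> x' \<and> x' \<le> z \<and> z \<le> y' \<and> y' \<le> b \<and> x' < y' \<longrightarrow> chord f x y z \<le> chord f x' y' z)"

lemma convex_concave_envelope:
  fixes f :: "real \<Rightarrow> real"
  assumes c: "a < c" "c < b" and cont: "continuous_on {a..b} f"
    and cvx: "strictly_convex a c f" and ccv: "strictly_concave c b f"
    and below: "a < z0" "z0 < b" "f z0 \<le> chord f a b z0"
  obtains T m n where "a < T" "T < b" "f T = m * T + n" "f b = m * b + n"
    "\<And>z. a \<le> z \<Longrightarrow> z \<le> b \<Longrightarrow> m * z + n \<le> f z"
    "\<And>z z1. a < z1 \<Longrightarrow> z1 < z \<Longrightarrow> z < b \<Longrightarrow> chord_optimal f a b z1 b z \<Longrightarrow> z1 = T"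
    "\<And>z z2. a < z \<Longrightarrow> z < z2 \<Longrightarrow> z2 < b \<Longrightarrow> \<not> chord_optimal f a b a z2 z"
proof -
  obtain T m n where T: "a < T" "T \<le> c" "f T = m * T + n" "f b = m * b + n"
    and pos: "\<And>z. a \<le> z \<Longrightarrow> z < b \<Longrightarrow> z \<noteq> T \<Longrightarrow> m * z + n < f z"
    using convex_concave_tangent[OF c cont cvx ccv below] by blast
  show thesis
  proof (rule that[of T m n])
    show "m * z + n \<le> f z" if "a \<le> z" "z \<le> b" for z
      using pos[of z] T that by (cases "z = T"; cases "z = b") auto
    show "z1 = T" if "a < z1" "z1 < z" "z < b" "chord_optimal f a b z1 b z" for z z1
      using T(1,2) c(2) T(3,4) pos cvx that(1-3)
    proof (rule convex_concave_upper_unique)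
      fix x assume "a < x" "x \<le> z"
      then show "chord f z1 b z \<le> chord f x b z"
        using that by (simp add: chord_optimal_def)
    qed
    show "\<not> chord_optimal f a b a z2 z" if "a < z" "z < z2" "z2 < b" for z z2
    proof
      assume opt: "chord_optimal f a b a z2 z"
      show False using c cvx ccv that
      proof (rule convex_concave_no_lower)
        fix y assume "z \<le> y" "y \<le> b"
        then show "chord f a z2 z \<le> chord f a y z"
          using that opt by (simp add: chord_optimal_def)
      qed
    qed
  qed (use T c in auto)
qed

lemma chord_optimal_reflect:
  "chord_optimal (\<lambda>z. f (- z)) (- b) (- a) (- y) (- x) (- z) \<longleftrightarrow> chord_optimal f a b x y z"
  (is "?l \<longleftrightarrow> ?r")
proof
  assume l: ?l
  show ?r
    unfolding chord_optimal_def
  proof (intro allI impI)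
    fix x' y' assume "a \<le> x' \<and> x' \<le> z \<and> z \<le> y' \<and> y' \<le> b \<and> x' < y'"
    then have "chord (\<lambda>z. f (- z)) (- y) (- x) (- z) \<le> chord (\<lambda>z. f (- z)) (- y') (- x') (- z)"
      using l by (auto simp: chord_optimal_def)
    then show "chord f x y z \<le> chord f x' y' z" by (simp only: chord_reflect)
  qed
next
  assume r: ?r
  show ?l
    unfolding chord_optimal_def chord_reflect
  proof (intro allI impI)
    fix x' y' assume "- b \<le> x' \<and> x' \<le> - z \<and> - z \<le> y' \<and> y' \<le> - a \<and> x' < y'"
    then have "chord f x y z \<le> chord f (- y') (- x') z"
      using r by (auto simp: chord_optimal_def)
    then show "chord f x y z \<le> chord (\<lambda>z. f (- z)) x' y' (- z)"
      using chord_reflect[of f "- x'" "- y'" z] by simp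
  qed
qed

text \<open>Reflection in 0 exchanges the end points and the order of the two pieces, and changes
  the sign of the slope \<open>m\<close>.\<close>

lemma concave_convex_envelope:
  fixes f :: "real \<Rightarrow> real"
  assumes c: "a < c" "c < b" and cont: "continuous_on {a..b} f"
    and ccv: "strictly_concave a c f" and cvx: "strictly_convex c b f"
    and below: "a < z0" "z0 < b" "f z0 \<le> chord f a b z0"
  obtains T m n where "a < T" "T < b" "f T = m * T + n" "f a = m * a + n"
    "\<And>z. a \<le> z \<Longrightarrow> z \<le> b \<Longrightarrow> m * z + n \<le> f z"
    "\<And>z z2. a < z \<Longrightarrow> z < z2 \<Longrightarrow> z2 < b \<Longrightarrow> chord_optimal f a b a z2 z \<Longrightarrow> z2 = T"
    "\<And>z z1. a < z1 \<Longrightarrow> z1 < z \<Longrightarrow> z < b \<Longrightarrow> \<not> chord_optimal f a b z1 b z"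
proof -
  let ?f = "\<lambda>z. f (- z)"
  have "continuous_on {- b..- a} ?f"
    by (rule continuous_on_compose2[OF cont]) (auto intro!: continuous_intros)
  moreover have "strictly_convex (- b) (- c) ?f"
    using strictly_convex_reflect[OF cvx, of 0] by simp
  moreover have "strictly_concave (- c) (- a) ?f"
    using strictly_convex_reflect[OF ccv[unfolded strictly_concave_def], of 0]
    by (simp add: strictly_concave_def)
  moreover have "?f (- z0) \<le> chord ?f (- b) (- a) (- z0)"
    using below chord_reflect[of f b a z0] by simp
  ultimately obtain T m n where T: "- b < T" "T < - a" "?f T = m * T + n" "?f (- a) = m * (- a) + n"
    "\<And>z. - b \<le> z \<Longrightarrow> z \<le> - a \<Longrightarrow> m * z + n \<le> ?f z"
    "\<And>z z1. - b < z1 \<Longrightarrow> z1 < z \<Longrightarrow> z < - a \<Longrightarrow> chord_optimal ?f (- b) (- a) z1 (- a) z \<Longrightarrow> z1 = T"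
    "\<And>z z2. - b < z \<Longrightarrow> z < z2 \<Longrightarrow> z2 < - a \<Longrightarrow> \<not> chord_optimal ?f (- b) (- a) (- b) z2 z"
    using convex_concave_envelope[of "- b" "- c" "- a" ?f "- z0"] c below by auto
  show thesis
  proof (rule that[of "- T" "- m" n])
    show "- m * z + n \<le> f z" if "a \<le> z" "z \<le> b" for z using T(5)[of "- z"] that by simp
    show "z2 = - T" if "a < z" "z < z2" "z2 < b" "chord_optimal f a b a z2 z" for z z2
      using T(6)[of "- z2" "- z"] that chord_optimal_reflect[of f b a z2 a z] by simp
    show "\<not> chord_optimal f a b z1 b z" if "a < z1" "z1 < z" "z < b" for z z1
      using T(7)[of "- z" "- z1"] that chord_optimal_reflect[of f b a b z1 z] by simp
  qed (use T in auto)
qed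

section \<open>The squared radius along the ellipse and the shape of the horizontal entropy\<close>

definition radius_sq :: "real \<Rightarrow> real \<Rightarrow> real \<Rightarrow> real \<Rightarrow> real" where
  "radius_sq l1 l3 z0 z = z\<^sup>2 + l1\<^sup>2 * (1 - (z - z0)\<^sup>2 / l3\<^sup>2)"

lemma radius_sq_ge:
  assumes "0 < l3" "z \<in> {z0 - l3..z0 + l3}"
  shows "z\<^sup>2 \<le> radius_sq l1 l3 z0 z"
proof -
  have "(z - z0)\<^sup>2 \<le> l3\<^sup>2" using assms by (intro power2_le_iff_abs_le[THEN iffD2]) auto
  then show ?thesis using assms by (simp add: radius_sq_def)
qed

lemma continuous_on_horizontal:
  assumes "0 < l3" and q: "\<And>z. z \<in> {z0 - l3..z0 + l3} \<Longrightarrow> radius_sq l1 l3 z0 z \<le> 1"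
  shows "continuous_on {z0 - l3..z0 + l3} (\<lambda>z. bin_entropy (sqrt (radius_sq l1 l3 z0 z)))"
proof (rule continuous_on_compose2[OF continuous_on_bin_entropy])
  show "continuous_on {z0 - l3..z0 + l3} (\<lambda>z. sqrt (radius_sq l1 l3 z0 z))"
    unfolding radius_sq_def using assms(1) by (intro continuous_intros) auto
  show "(\<lambda>z. sqrt (radius_sq l1 l3 z0 z)) ` {z0 - l3..z0 + l3} \<subseteq> {0..1}"
    using q radius_sq_ge[OF assms(1)] by (force intro: order_trans[OF zero_le_power2])
qed

text \<open>The exact convexity defect of a quadratic is its leading coefficient times
  \<open>t * (1 - t) * (x - y)\<^sup>2\<close>; comparing \<open>l1\<close> with \<open>l3\<close>
  decides the sign.\<close>

lemma radius_sq_convex_comb: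
  "radius_sq l1 l3 z0 ((1 - t) * x + t * y)
    = (1 - t) * radius_sq l1 l3 z0 x + t * radius_sq l1 l3 z0 y
      - (1 - l1\<^sup>2 / l3\<^sup>2) * (t * (1 - t) * (x - y)\<^sup>2)"
proof -
  define \<kappa> where "\<kappa> = l1\<^sup>2 / l3\<^sup>2"
  have e: "radius_sq l1 l3 z0 z = z\<^sup>2 + l1\<^sup>2 - \<kappa> * (z - z0)\<^sup>2" for z
    by (simp add: radius_sq_def \<kappa>_def algebra_simps)
  show ?thesis
    unfolding \<kappa>_def[symmetric] e by (simp add: algebra_simps power2_eq_square)
qed

lemma horizontal_concave:
  assumes l: "0 < l3" "0 \<le> l1" "l1 \<le> l3"
    and q: "\<And>z. z \<in> {z0 - l3..z0 + l3} \<Longrightarrow> radius_sq l1 l3 z0 z \<le> 1"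
  shows "concave_on {z0 - l3..z0 + l3} (\<lambda>z. bin_entropy (sqrt (radius_sq l1 l3 z0 z)))"
  unfolding concave_on_def
proof (rule convex_onI)
  fix t x y :: real
  assume t: "0 < t" "t < 1" and xy: "x \<in> {z0 - l3..z0 + l3}" "y \<in> {z0 - l3..z0 + l3}"
  let ?q = "radius_sq l1 l3 z0" and ?w = "(1 - t) * x + t * y"
  have w: "?w \<in> {z0 - l3..z0 + l3}"
    using convexD[OF convex_real_interval(5), of x "z0 - l3" "z0 + l3" y "1 - t" t] xy t by simp
  have q01: "0 \<le> ?q z" "?q z \<le> 1" if "z \<in> {z0 - l3..z0 + l3}" for z
    using q[OF that] radius_sq_ge[OF l(1) that, of l1] by (auto intro: order_trans[OF zero_le_power2])
  have "l1\<^sup>2 / l3\<^sup>2 \<le> 1" using l by (simp add: power_mono)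
  then have "0 \<le> (1 - l1\<^sup>2 / l3\<^sup>2) * (t * (1 - t) * (x - y)\<^sup>2)" using t by simp
  then have "?q ?w \<le> (1 - t) * ?q x + t * ?q y"
    using radius_sq_convex_comb[of l1 l3 z0 t x y] by linarith
  moreover have "(1 - t) * ?q x + t * ?q y \<in> {0..1}"
    using convexD[OF convex_real_interval(5), of "?q x" 0 1 "?q y" "1 - t" t] q01 xy t by simp
  ultimately have "bin_entropy (sqrt ((1 - t) * ?q x + t * ?q y)) \<le> bin_entropy (sqrt (?q ?w))"
    using q01[OF w] by (intro bin_entropy_antimono) auto
  moreover have "(1 - t) * bin_entropy (sqrt (?q x)) + t * bin_entropy (sqrt (?q y))
      \<le> bin_entropy (sqrt ((1 - t) * ?q x + t * ?q y))"
    using concave_onD[OF bin_entropy_sqrt_concave, of t "?q x" "?q y"] t q01 xy by simp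
  ultimately show "- bin_entropy (sqrt (?q ((1 - t) *\<^sub>R x + t *\<^sub>R y)))
      \<le> (1 - t) * - bin_entropy (sqrt (?q x)) + t * - bin_entropy (sqrt (?q y))"
    by simp
qed simp

text \<open>Completing the square: for \<open>l3 < l1\<close> the leading coefficient is
  \<open>- k\<close>, and \<open>c\<close> is the height of the apex, which may lie outside the
  ellipse.\<close>

lemma radius_sq_vertex_form:
  assumes "0 < l3" "l3 < l1"
  obtains k M c where "0 < k" "\<forall>z. radius_sq l1 l3 z0 z = M - k * (z - c)\<^sup>2"
proof -
  define \<kappa> where "\<kappa> = l1\<^sup>2 / l3\<^sup>2"
  define k where "k = \<kappa> - 1"
  have "l3\<^sup>2 < l1\<^sup>2" using assms by (intro power_strict_mono) auto
  then have k: "0 < k" using assms by (simp add: k_def \<kappa>_def)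
  define c where "c = \<kappa> * z0 / k"
  have kc: "k * c = \<kappa> * z0" using k by (simp add: c_def)
  have "radius_sq l1 l3 z0 z = (l1\<^sup>2 - \<kappa> * z0\<^sup>2 + k * c\<^sup>2) - k * (z - c)\<^sup>2" for z
  proof -
    have "radius_sq l1 l3 z0 z = z\<^sup>2 + l1\<^sup>2 - \<kappa> * (z - z0)\<^sup>2"
      by (simp add: radius_sq_def \<kappa>_def algebra_simps)
    also have "\<dots> = l1\<^sup>2 - \<kappa> * z0\<^sup>2 - k * z\<^sup>2 + 2 * z * (\<kappa> * z0)"
      by (simp add: k_def power2_eq_square algebra_simps)
    also have "\<dots> = (l1\<^sup>2 - \<kappa> * z0\<^sup>2 + k * c\<^sup>2) - k * (z - c)\<^sup>2"
      unfolding kc[symmetric] by (simp add: power2_eq_square algebra_simps)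
    finally show ?thesis .
  qed
  then show thesis using that k by blast
qed

text \<open>The profile is concave on the side nearer to the apex: an apex at or below the lower
  vertex yields concavity next to that vertex, one at or above the upper vertex yields concavity
  there.\<close>

lemma horizontal_shape:
  assumes l: "0 < l3" "l3 < l1"
    and q: "\<And>z. z \<in> {z0 - l3..z0 + l3} \<Longrightarrow> radius_sq l1 l3 z0 z \<le> 1"
    and ncvx: "\<not> convex_on {z0 - l3..z0 + l3} (\<lambda>z. bin_entropy (sqrt (radius_sq l1 l3 z0 z)))"
      (is "\<not> convex_on {?a..?b} ?g")
    and nccv: "\<not> concave_on {z0 - l3..z0 + l3} (\<lambda>z. bin_entropy (sqrt (radius_sq l1 l3 z0 z)))"
  obtains c where "z0 - l3 < c" "c < z0 + l3"
      "strictly_convex (z0 - l3) c ?g" "strictly_concave c (z0 + l3) ?g"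
  | c where "z0 - l3 < c" "c < z0 + l3"
      "strictly_concave (z0 - l3) c ?g" "strictly_convex c (z0 + l3) ?g"
proof -
  obtain k M c where k: "0 < k" and Q: "\<And>z. radius_sq l1 l3 z0 z = M - k * (z - c)\<^sup>2"
    using radius_sq_vertex_form[OF l, of z0] by blast
  have q0: "0 \<le> radius_sq l1 l3 z0 z" if "z \<in> {?a..?b}" for z
    using radius_sq_ge[OF l(1) that, of l1] by (rule order_trans[OF zero_le_power2])
  have w01: "0 \<le> M - k * (z - c)\<^sup>2" "M - k * (z - c)\<^sup>2 \<le> 1" if "z \<in> {?a..?b}" for z
    using q[OF that] q0[OF that] by (simp_all add: Q)
  have g1: "?g = (\<lambda>z. entropy_profile M k (z - c))" by (simp add: entropy_profile_def Q)
  have g2: "?g = (\<lambda>z. entropy_profile M k (c - z))"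
    by (simp add: entropy_profile_def Q power2_commute)
  have ab: "?a < ?b" using l by simp
  consider "c \<le> ?a" | "?b \<le> c" | "?a < c" "c < ?b" by linarith
  then show thesis
  proof cases
    case 1
    have cont: "continuous_on {?a - c..?b - c} (entropy_profile M k)"
    proof (rule continuous_on_entropy_profile)
      fix t assume "t \<in> {?a - c..?b - c}"
      then show "0 \<le> M - k * t\<^sup>2 \<and> M - k * t\<^sup>2 \<le> 1" using w01[of "t + c"] by simp
    qed
    have "0 \<le> ?a - c" "?a - c < ?b - c" "0 \<le> M - k * (?b - c)\<^sup>2" "M - k * (?a - c)\<^sup>2 \<le> 1"
      using 1 ab w01 by auto
    then show thesis using cont
    proof (rule entropy_profile_shape[OF k])
      assume "strictly_convex (?a - c) (?b - c) (entropy_profile M k)"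
      from strictly_convex_shift[OF this, of c] have "strictly_convex ?a ?b ?g" by (simp add: g1)
      then show thesis using ncvx strictly_convex_imp_convex_on by blast
    next
      assume "strictly_concave (?a - c) (?b - c) (entropy_profile M k)"
      from strictly_convex_shift[OF this[unfolded strictly_concave_def], of c]
      have "strictly_concave ?a ?b ?g" by (simp add: g1 strictly_concave_def)
      then show thesis using nccv strictly_concave_imp_concave_on by blast
    next
      fix d assume d: "?a - c < d" "d < ?b - c" "strictly_concave (?a - c) d (entropy_profile M k)"
        "strictly_convex d (?b - c) (entropy_profile M k)"
      have "strictly_concave ?a (d + c) ?g"
        using strictly_convex_shift[OF d(3)[unfolded strictly_concave_def], of c]
        by (simp add: g1 strictly_concave_def)
      moreover have "strictly_convex (d + c) ?b ?g"
        using strictly_convex_shift[OF d(4), of c] by (simp add: g1)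
      ultimately show thesis using that(2)[of "d + c"] d(1,2) by simp
    qed
  next
    case 2
    have cont: "continuous_on {c - ?b..c - ?a} (entropy_profile M k)"
    proof (rule continuous_on_entropy_profile)
      fix t assume "t \<in> {c - ?b..c - ?a}"
      then show "0 \<le> M - k * t\<^sup>2 \<and> M - k * t\<^sup>2 \<le> 1" using w01[of "c - t"] by simp
    qed
    have "0 \<le> c - ?b" "c - ?b < c - ?a" "0 \<le> M - k * (c - ?a)\<^sup>2" "M - k * (c - ?b)\<^sup>2 \<le> 1"
      using 2 ab w01[of ?a] w01[of ?b] by (auto simp: power2_commute)
    then show thesis using cont
    proof (rule entropy_profile_shape[OF k])
      assume "strictly_convex (c - ?b) (c - ?a) (entropy_profile M k)"
      from strictly_convex_reflect[OF this, of c] have "strictly_convex ?a ?b ?g" by (simp add: g2)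
      then show thesis using ncvx strictly_convex_imp_convex_on by blast
    next
      assume "strictly_concave (c - ?b) (c - ?a) (entropy_profile M k)"
      from strictly_convex_reflect[OF this[unfolded strictly_concave_def], of c]
      have "strictly_concave ?a ?b ?g" by (simp add: g2 strictly_concave_def)
      then show thesis using nccv strictly_concave_imp_concave_on by blast
    next
      fix d assume d: "c - ?b < d" "d < c - ?a" "strictly_concave (c - ?b) d (entropy_profile M k)"
        "strictly_convex d (c - ?a) (entropy_profile M k)"
      have "strictly_concave (c - d) ?b ?g"
        using strictly_convex_reflect[OF d(3)[unfolded strictly_concave_def], of c]
        by (simp add: g2 strictly_concave_def)
      moreover have "strictly_convex ?a (c - d) ?g"
        using strictly_convex_reflect[OF d(4), of c] by (simp add: g2)
      ultimately show thesis using that(1)[of "c - d"] d(1,2) by simp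
    qed
  next
    case 3
    \<comment> \<open>The larger of the two distances lets one profile on [0, r] serve both sides of
      the apex. It is convex and increasing, so its composition with the convex distance from
      \<open>c\<close> is convex.\<close>
    define r where "r = max (c - ?a) (?b - c)"
    have "M \<le> 1" using w01[of c] 3 by simp
    have w0: "0 \<le> M - k * r\<^sup>2" using w01[of ?a] w01[of ?b] ab
      by (auto simp: r_def max_def power2_commute)
    have w: "0 \<le> M - k * t\<^sup>2" "M - k * t\<^sup>2 \<le> 1" if "0 \<le> t" "t \<le> r" for t
    proof -
      have "k * t\<^sup>2 \<le> k * r\<^sup>2" "0 \<le> k * t\<^sup>2" using that k by (simp_all add: power_mono)
      then show "0 \<le> M - k * t\<^sup>2" "M - k * t\<^sup>2 \<le> 1" using w0 \<open>M \<le> 1\<close> by linarith+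
    qed
    have "strictly_convex 0 r (entropy_profile M k)"
      using k \<open>M \<le> 1\<close> w0 w by (intro entropy_profile_convex_small continuous_on_entropy_profile) auto
    then have cvx: "convex_on {0..r} (entropy_profile M k)" by (rule strictly_convex_imp_convex_on)
    have mono: "entropy_profile M k s \<le> entropy_profile M k t" if "0 \<le> s" "s \<le> t" "t \<le> r" for s t
    proof -
      have "k * s\<^sup>2 \<le> k * t\<^sup>2" using that k by (simp add: power_mono)
      then show ?thesis unfolding entropy_profile_def
        using w[of t] w[of s] that by (intro bin_entropy_antimono) auto
    qed
    have g3: "?g = (\<lambda>z. entropy_profile M k \<bar>z - c\<bar>)" by (simp add: entropy_profile_def Q)
    have "convex_on {?a..?b} ?g" unfolding g3
    proof (rule convex_onI)
      fix t x y :: real assume t: "0 < t" "t < 1" and xy: "x \<in> {?a..?b}" "y \<in> {?a..?b}"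
      have r: "\<bar>x - c\<bar> \<in> {0..r}" "\<bar>y - c\<bar> \<in> {0..r}" using xy by (auto simp: r_def)
      have "\<bar>(1 - t) * x + t * y - c\<bar> = \<bar>(1 - t) * (x - c) + t * (y - c)\<bar>" by (simp add: algebra_simps)
      also have "\<dots> \<le> \<bar>(1 - t) * (x - c)\<bar> + \<bar>t * (y - c)\<bar>" by (rule abs_triangle_ineq)
      also have "\<dots> = (1 - t) * \<bar>x - c\<bar> + t * \<bar>y - c\<bar>" using t by (simp add: abs_mult)
      finally have "\<bar>(1 - t) * x + t * y - c\<bar> \<le> (1 - t) * \<bar>x - c\<bar> + t * \<bar>y - c\<bar>" .
      moreover have "(1 - t) * \<bar>x - c\<bar> + t * \<bar>y - c\<bar> \<in> {0..r}"
        using convexD[OF convex_real_interval(5) r, of "1 - t" t] t by simp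
      ultimately have "entropy_profile M k \<bar>(1 - t) * x + t * y - c\<bar>
          \<le> entropy_profile M k ((1 - t) * \<bar>x - c\<bar> + t * \<bar>y - c\<bar>)" by (intro mono) auto
      also have "\<dots> \<le> (1 - t) * entropy_profile M k \<bar>x - c\<bar> + t * entropy_profile M k \<bar>y - c\<bar>"
        using convex_onD[OF cvx, of t "\<bar>x - c\<bar>" "\<bar>y - c\<bar>"] t r by simp
      finally show "entropy_profile M k \<bar>(1 - t) *\<^sub>R x + t *\<^sub>R y - c\<bar>
          \<le> (1 - t) * entropy_profile M k \<bar>x - c\<bar> + t * entropy_profile M k \<bar>y - c\<bar>" by simp
    qed simp
    then show thesis using ncvx by blast
  qed
qed

section \<open>Steering ellipsoids of X states\<close>

lemma X_state_parameters:
  assumes "X_state \<rho>"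
  obtains a b c d u v where "\<rho> = X_matrix a b c d u v"
    "0 \<le> a" "0 \<le> b" "0 \<le> c" "0 \<le> d" "a + b + c + d = 1"
    "0 \<le> u" "0 \<le> v" "u\<^sup>2 \<le> a * d" "v\<^sup>2 \<le> b * c" "0 < a + b" "0 < c + d"
proof -
  obtain a b c d u v where *: "\<rho> = X_matrix a b c d u v"
    "0 \<le> a" "0 \<le> b" "0 \<le> c" "0 \<le> d" "a + b + c + d = 1"
    "0 \<le> u" "0 \<le> v" "u\<^sup>2 \<le> a * d" "v\<^sup>2 \<le> b * c" "(a + b) * (c + d) > 0"
    using assms unfolding X_state_def by blast
  have "a + b \<noteq> 0" "c + d \<noteq> 0" using *(11) by auto
  then have "0 < a + b" "0 < c + d" using * by auto
  then show thesis using that * by blast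
qed

text \<open>The two quotients are the heights of the states of \<open>B\<close> after the two
  outcomes of the standard-basis measurement of \<open>A\<close>. Their midpoint is the center and
  half their distance is \<open>ell3\<close>, so these states are the vertices.\<close>

lemma z_center_X_matrix:
  assumes "0 < a + b" "0 < c + d"
  shows "z_center (X_matrix a b c d u v) = ((a - b) / (a + b) + (c - d) / (c + d)) / 2"
  using assms by (simp add: z_center_def norm_factor_def divide_simps) (simp add: algebra_simps)

lemma ell3_X_matrix:
  assumes "0 < a + b" "0 < c + d"
  shows "ell3 (X_matrix a b c d u v) = \<bar>(a - b) / (a + b) - (c - d) / (c + d)\<bar> / 2"
proof -
  have "(a - b) / (a + b) - (c - d) / (c + d) = 2 * ((a * d - b * c) / ((a + b) * (c + d)))"
    using assms by (simp add: divide_simps) (simp add: algebra_simps)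
  also have "\<bar>\<dots>\<bar> = 2 * ell3 (X_matrix a b c d u v)"
    unfolding abs_mult abs_divide using assms by (simp add: ell3_def norm_factor_def)
  finally show ?thesis by simp
qed

lemma ell_nonneg:
  assumes "X_state \<rho>"
  shows "0 \<le> ell2 \<rho>" "ell2 \<rho> \<le> ell1 \<rho>" "0 \<le> ell1 \<rho>" "0 \<le> ell3 \<rho>"
proof -
  obtain a b c d u v where *: "\<rho> = X_matrix a b c d u v" "0 \<le> u" "0 \<le> v" "0 < a + b" "0 < c + d"
    using X_state_parameters[OF assms] by metis
  then show "0 \<le> ell2 \<rho>" "ell2 \<rho> \<le> ell1 \<rho>" "0 \<le> ell1 \<rho>" "0 \<le> ell3 \<rho>"
    by (auto simp: ell1_def ell2_def ell3_def norm_factor_def intro!: divide_right_mono)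
qed

lemma S_horizontal_eq:
  "S_horizontal \<rho> z = bin_entropy (sqrt (radius_sq (ell1 \<rho>) (ell3 \<rho>) (z_center \<rho>) z))"
  by (simp add: S_horizontal_def radius_sq_def)

lemma convex_coordinate:
  fixes p r z :: real
  assumes "p \<noteq> r" "z \<in> {(p + r) / 2 - \<bar>p - r\<bar> / 2..(p + r) / 2 + \<bar>p - r\<bar> / 2}"
  obtains t where "0 \<le> t" "t \<le> 1" "z = t * p + (1 - t) * r"
proof
  define t where "t = (z - r) / (p - r)"
  have "t * (p - r) = z - r" using assms by (simp add: t_def)
  then show "z = t * p + (1 - t) * r" by (simp add: algebra_simps)
  show "0 \<le> t" "t \<le> 1" using assms by (auto simp: t_def divide_simps abs_if split: if_splits)
qed

text \<open>With \<open>z = t * zP + (1 - t) * zR\<close>, where \<open>zP\<close> and \<open>zR\<close> are the heights of the states of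
  \<open>B\<close> after measuring \<open>A\<close> in the standard basis, \<open>1 - z\<^sup>2\<close> minus the horizontal term is a quadratic
  form in \<open>t\<close> and \<open>1 - t\<close>; it is nonnegative by AM-GM.\<close>
lemma radius_sq_le_1:
  assumes X: "X_state \<rho>" and "0 < ell3 \<rho>" and z: "z \<in> {z_H \<rho>..z_G \<rho>}"
  shows "radius_sq (ell1 \<rho>) (ell3 \<rho>) (z_center \<rho>) z \<le> 1"
proof -
  obtain a b c d u v where \<rho>: "\<rho> = X_matrix a b c d u v"
    and pos: "0 \<le> a" "0 \<le> b" "0 \<le> c" "0 \<le> d" "0 \<le> u" "0 \<le> v" "u\<^sup>2 \<le> a * d" "v\<^sup>2 \<le> b * c"
      "0 < a + b" "0 < c + d"
    using X_state_parameters[OF X] by metis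
  define \<alpha> \<beta> where ab: "\<alpha> = a + b" "\<beta> = c + d"
  have ab0: "0 < \<alpha>" "0 < \<beta>" using pos by (simp_all add: ab)
  define p r where pr: "p = (a - b) / \<alpha>" "r = (c - d) / \<beta>"
  have z0: "z_center \<rho> = (p + r) / 2" and l3: "ell3 \<rho> = \<bar>p - r\<bar> / 2"
    using pos by (simp_all add: \<rho> z_center_X_matrix ell3_X_matrix pr ab)
  have "p \<noteq> r" using assms(2) l3 by auto
  then obtain t where t: "0 \<le> t" "t \<le> 1" "z = t * p + (1 - t) * r"
    using convex_coordinate[of p r z] z by (auto simp: z_H_def z_G_def z0 l3)
  have "(z - z_center \<rho>)\<^sup>2 / (ell3 \<rho>)\<^sup>2 = ((2 * t - 1) * ((p - r) / 2))\<^sup>2 / ((p - r) / 2)\<^sup>2"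
    by (simp add: z0 l3 t power_divide) (simp add: algebra_simps power2_eq_square)
  also have "\<dots> = (2 * t - 1)\<^sup>2"
    unfolding power_mult_distrib using \<open>p \<noteq> r\<close> by (intro nonzero_mult_div_cancel_right) simp
  finally have h: "1 - (z - z_center \<rho>)\<^sup>2 / (ell3 \<rho>)\<^sup>2 = 4 * (t * (1 - t))"
    by (simp add: algebra_simps power2_eq_square)
  have l1: "(ell1 \<rho>)\<^sup>2 = (u + v)\<^sup>2 / (\<alpha> * \<beta>)"
    using ab0 by (simp add: \<rho> ell1_def norm_factor_def ab power_divide)
  \<comment> \<open>The diagonal entries, rescaled so that the two outcomes of \<open>A\<close> have
    probabilities \<open>t\<close> and \<open>1 - t\<close>; then \<open>z\<close> is the height of
    the resulting state of \<open>B\<close>.\<close>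
  define A B C D where ABCD: "A = t * a / \<alpha>" "B = t * b / \<alpha>" "C = (1 - t) * c / \<beta>" "D = (1 - t) * d / \<beta>"
  have pos': "0 \<le> A" "0 \<le> B" "0 \<le> C" "0 \<le> D" using pos ab0 t by (simp_all add: ABCD)
  have AB: "A + B = t" "C + D = 1 - t"
    using ab0 by (simp_all add: ABCD add_divide_distrib[symmetric] distrib_left[symmetric] ab[symmetric])
  have zz: "z = A - B + C - D"
    by (simp add: ABCD t pr diff_divide_distrib right_diff_distrib)
  have z1: "1 + z = 2 * (A + C)" "1 - z = 2 * (B + D)" using AB zz by auto
  have "(1 + z) * (1 - z) = 4 * ((A + C) * (B + D))"
    unfolding z1 by (simp add: algebra_simps)
  then have zsq: "1 - z\<^sup>2 = 4 * (A * B + C * D + A * D + B * C)"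
    by (simp add: power2_eq_square algebra_simps)
  define K where "K = t * (1 - t) / (\<alpha> * \<beta>)"
  have K: "0 \<le> K" using t ab0 by (simp add: K_def)
  have AD: "A * D = K * (a * d)" and BC: "B * C = K * (b * c)"
    by (simp_all add: ABCD K_def)
  \<comment> \<open>Regrouping \<open>(A * D) * (B * C)\<close> as \<open>(A * B) * (C * D)\<close>
    lets AM-GM absorb the cross term of \<open>(u + v)\<^sup>2\<close>.\<close>
  have "(2 * (K * (u * v)))\<^sup>2 = 4 * ((K * u\<^sup>2) * (K * v\<^sup>2))"
    by (simp add: power2_eq_square)
  also have "\<dots> \<le> 4 * ((A * D) * (B * C))"
    unfolding AD BC using pos K by (intro mult_left_mono mult_mono) auto
  also have "\<dots> \<le> (A * B + C * D)\<^sup>2"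
    using sum_squares_bound[of "A * B" "C * D"] by (simp add: power2_eq_square algebra_simps)
  finally have "2 * (K * (u * v)) \<le> A * B + C * D"
    by (rule power2_le_imp_le) (use pos' in simp)
  moreover have "K * u\<^sup>2 \<le> A * D" "K * v\<^sup>2 \<le> B * C"
    unfolding AD BC using pos K by (auto intro: mult_left_mono)
  moreover have e: "K * (u + v)\<^sup>2 = K * u\<^sup>2 + K * v\<^sup>2 + 2 * (K * (u * v))"
    by (simp add: power2_eq_square algebra_simps)
  ultimately have "K * (u + v)\<^sup>2 \<le> A * B + C * D + A * D + B * C" unfolding e by linarith
  then have "4 * (K * (u + v)\<^sup>2) \<le> 1 - z\<^sup>2" unfolding zsq by simp
  moreover have "(ell1 \<rho>)\<^sup>2 * (4 * (t * (1 - t))) = 4 * (K * (u + v)\<^sup>2)"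
    by (simp add: l1 K_def)
  ultimately show ?thesis by (simp add: radius_sq_def h)
qed

text \<open>\<open>z_B\<close> mixes the heights of the two vertices with the outcome probabilities
  \<open>a + b\<close> and \<open>c + d\<close>, both positive.\<close>

lemma z_B_between:
  assumes X: "X_state \<rho>" and "0 < ell3 \<rho>"
  shows "z_H \<rho> < z_B \<rho>" "z_B \<rho> < z_G \<rho>"
proof -
  obtain a b c d u v where \<rho>: "\<rho> = X_matrix a b c d u v"
    and pos: "a + b + c + d = 1" "0 < a + b" "0 < c + d"
    using X_state_parameters[OF X] by metis
  define p r where pr: "p = (a - b) / (a + b)" "r = (c - d) / (c + d)"
  have z0: "z_center \<rho> = (p + r) / 2" and l3: "ell3 \<rho> = \<bar>p - r\<bar> / 2"
    using pos by (simp_all add: \<rho> z_center_X_matrix ell3_X_matrix pr)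
  have "a - b = (a + b) * p" "c - d = (c + d) * r" using pos by (simp_all add: pr)
  then have zB: "z_B \<rho> = (a + b) * p + (c + d) * r" by (simp add: \<rho> z_B_def)
  have "p \<noteq> r" using assms(2) l3 by auto
  have cd: "c + d = 1 - (a + b)" using pos by simp
  have "z_B \<rho> - z_center \<rho> = ((a + b) - (c + d)) * ((p - r) / 2)"
    unfolding zB z0 cd by (simp add: algebra_simps add_divide_distrib diff_divide_distrib)
  then have "\<bar>z_B \<rho> - z_center \<rho>\<bar> = \<bar>(a + b) - (c + d)\<bar> * ell3 \<rho>"
    by (simp only: l3 abs_mult abs_divide abs_numeral)
  also have "\<dots> < 1 * ell3 \<rho>"
    using assms(2) pos by (intro mult_strict_right_mono) (auto simp: abs_if)
  finally have "\<bar>z_B \<rho> - z_center \<rho>\<bar> < ell3 \<rho>" by simp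
  then show "z_H \<rho> < z_B \<rho>" "z_B \<rho> < z_G \<rho>" by (auto simp: z_H_def z_G_def)
qed

text \<open>Filtering qubit \<open>A\<close> by a diagonal operator changes \<open>\<rho>\<^sup>B\<close> but not the steering ellipsoid.\<close>
lemma X_state_with_z_B:
  assumes X: "X_state \<rho>" and "0 < ell3 \<rho>" and z: "z_H \<rho> < z" "z < z_G \<rho>"
  obtains \<rho>' where "X_state \<rho>'" "ell1 \<rho>' = ell1 \<rho>" "ell2 \<rho>' = ell2 \<rho>" "ell3 \<rho>' = ell3 \<rho>"
    "z_center \<rho>' = z_center \<rho>" "z_B \<rho>' = z"
proof -
  obtain a b c d u v where \<rho>: "\<rho> = X_matrix a b c d u v"
    and pos: "0 \<le> a" "0 \<le> b" "0 \<le> c" "0 \<le> d" "0 \<le> u" "0 \<le> v" "u\<^sup>2 \<le> a * d" "v\<^sup>2 \<le> b * c"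
      "0 < a + b" "0 < c + d"
    using X_state_parameters[OF X] by metis
  define p r where pr: "p = (a - b) / (a + b)" "r = (c - d) / (c + d)"
  have z0: "z_center \<rho> = (p + r) / 2" and l3: "ell3 \<rho> = \<bar>p - r\<bar> / 2"
    using pos by (simp_all add: \<rho> z_center_X_matrix ell3_X_matrix pr)
  have "p \<noteq> r" using assms(2) l3 by auto
  then obtain t where t: "0 \<le> t" "t \<le> 1" "z = t * p + (1 - t) * r"
    using convex_coordinate[of p r z] z by (auto simp: z_H_def z_G_def z0 l3)
  have "t \<noteq> 0" "t \<noteq> 1" using z t by (auto simp: z_H_def z_G_def z0 l3 abs_if field_simps split: if_splits)
  with t have t01: "0 < t" "t < 1" by auto
  \<comment> \<open>The outcomes of \<open>A\<close> get probabilities \<open>t\<close> and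
    \<open>1 - t\<close>. Scaling the off-diagonal entries by the geometric mean of \<open>x\<close>
    and \<open>y\<close> leaves all quotients that define the ellipsoid unchanged.\<close>
  define x y where xy: "x = t / (a + b)" "y = (1 - t) / (c + d)"
  have xy0: "0 < x" "0 < y" using t01 pos by (simp_all add: xy)
  have xab: "x * (a + b) = t" "y * (c + d) = 1 - t" using pos by (simp_all add: xy)
  define s where "s = sqrt (x * y)"
  have s: "0 < s" "s\<^sup>2 = x * y" using xy0 by (simp_all add: s_def)
  define \<rho>' where \<rho>': "\<rho>' = X_matrix (x * a) (x * b) (y * c) (y * d) (s * u) (s * v)"
  have sums: "x * a + x * b = x * (a + b)" "y * c + y * d = y * (c + d)" by (simp_all add: distrib_left)
  show thesis
  proof (rule that[of \<rho>'])
    have "(s * u)\<^sup>2 \<le> x * a * (y * d)" "(s * v)\<^sup>2 \<le> x * b * (y * c)"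
      using mult_left_mono[OF pos(7), of "x * y"] mult_left_mono[OF pos(8), of "x * y"] xy0
      by (simp_all add: power_mult_distrib s(2) mult_ac)
    moreover have "x * a + x * b + y * c + y * d = 1" using xab by (simp add: distrib_left)
    moreover have "0 < (x * a + x * b) * (y * c + y * d)" unfolding sums using xy0 pos by simp
    moreover have "0 \<le> x * a" "0 \<le> x * b" "0 \<le> y * c" "0 \<le> y * d" "0 \<le> s * u" "0 \<le> s * v"
      using pos(1-6) xy0 s(1) by simp_all
    ultimately show "X_state \<rho>'" unfolding X_state_def \<rho>' by blast
    have N: "norm_factor \<rho>' = s\<^sup>2 * norm_factor \<rho>"
      by (simp add: norm_factor_def \<rho> \<rho>' sums s(2))
    have "s * u + s * v = s * (u + v)" "\<bar>s * u - s * v\<bar> = s * \<bar>u - v\<bar>"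
      using s(1) by (simp_all add: distrib_left right_diff_distrib[symmetric] abs_mult)
    then show "ell1 \<rho>' = ell1 \<rho>" "ell2 \<rho>' = ell2 \<rho>"
      using s(1) unfolding ell1_def ell2_def N by (simp_all add: \<rho> \<rho>' real_sqrt_mult)
    have "x * a * (y * d) - x * b * (y * c) = s\<^sup>2 * (a * d - b * c)"
      "x * a * (y * c) - x * b * (y * d) = s\<^sup>2 * (a * c - b * d)"
      by (simp_all add: s(2) algebra_simps)
    then show "ell3 \<rho>' = ell3 \<rho>" "z_center \<rho>' = z_center \<rho>"
      using s(1) unfolding ell3_def z_center_def N by (simp_all add: \<rho> \<rho>' abs_mult)
    have "x * a - x * b + y * c - y * d = t * p + (1 - t) * r"
    proof -
      have "x * (a - b) = t * p" "y * (c - d) = (1 - t) * r" by (simp_all add: xy pr)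
      then show ?thesis by (simp add: right_diff_distrib)
    qed
    then show "z_B \<rho>' = z" by (simp add: \<rho>' z_B_def t)
  qed
qed

section \<open>Parameters recovered from the ellipsoid, and the entropy of its surface
  points\<close>

text \<open>The extreme points of the smaller body in the directions +x, +z and -z are located in
  the larger one, whose coordinates are bounded by its own semiaxes.\<close>

lemma steering_ellipsoid_subset:
  assumes "steering_ellipsoid \<rho> \<subseteq> steering_ellipsoid \<rho>'" "0 \<le> ell1 \<rho>'" "0 \<le> ell3 \<rho>'"
  shows "ell1 \<rho> \<le> ell1 \<rho>'" "z_G \<rho> \<le> z_G \<rho>'" "z_H \<rho>' \<le> z_H \<rho>"
proof -
  have unit: "n1 \<le> 1" "- 1 \<le> n3" "n3 \<le> 1" if "n1\<^sup>2 + n2\<^sup>2 + n3\<^sup>2 \<le> 1" for n1 n2 n3 :: real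
  proof -
    have "n1\<^sup>2 \<le> 1" "n3\<^sup>2 \<le> 1" using that by (smt (verit) zero_le_power2)+
    then show "n1 \<le> 1" "- 1 \<le> n3" "n3 \<le> 1" by (auto simp: abs_square_le_1 abs_le_iff)
  qed
  have mem: "\<exists>n1 n2 n3. n1\<^sup>2 + n2\<^sup>2 + n3\<^sup>2 \<le> 1 \<and> ell1 \<rho> * m1 = ell1 \<rho>' * n1 \<and>
      z_center \<rho> + ell3 \<rho> * m3 = z_center \<rho>' + ell3 \<rho>' * n3"
    if "m1\<^sup>2 + 0\<^sup>2 + m3\<^sup>2 \<le> 1" for m1 m3
  proof -
    have "vector [ell1 \<rho> * m1, ell2 \<rho> * 0, z_center \<rho> + ell3 \<rho> * m3] \<in> steering_ellipsoid \<rho>"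
      unfolding steering_ellipsoid_def using that by blast
    then have "(vector [ell1 \<rho> * m1, ell2 \<rho> * 0, z_center \<rho> + ell3 \<rho> * m3] :: real^3) \<in> steering_ellipsoid \<rho>'"
      using assms(1) by blast
    then show ?thesis
      unfolding steering_ellipsoid_def by (auto simp: vec_eq_iff forall_3)
  qed
  show "ell1 \<rho> \<le> ell1 \<rho>'"
  proof -
    obtain n1 n2 n3 where n: "n1\<^sup>2 + n2\<^sup>2 + n3\<^sup>2 \<le> 1" "ell1 \<rho> = ell1 \<rho>' * n1"
      using mem[of 1 0] by auto
    show ?thesis unfolding n(2) using unit(1)[OF n(1)] assms(2) by (rule mult_left_le)
  qed
  show "z_G \<rho> \<le> z_G \<rho>'"
  proof -
    obtain n1 n2 n3 where n: "n1\<^sup>2 + n2\<^sup>2 + n3\<^sup>2 \<le> 1" "z_center \<rho> + ell3 \<rho> = z_center \<rho>' + ell3 \<rho>' * n3"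
      using mem[of 0 1] by auto
    have "ell3 \<rho>' * n3 \<le> ell3 \<rho>'" using unit(3)[OF n(1)] assms(3) by (rule mult_left_le)
    then show ?thesis using n(2) by (simp add: z_G_def)
  qed
  show "z_H \<rho>' \<le> z_H \<rho>"
  proof -
    obtain n1 n2 n3 where n: "n1\<^sup>2 + n2\<^sup>2 + n3\<^sup>2 \<le> 1" "z_center \<rho> - ell3 \<rho> = z_center \<rho>' + ell3 \<rho>' * n3"
      using mem[of 0 "-1"] by auto
    have "ell3 \<rho>' * (- 1) \<le> ell3 \<rho>' * n3" using unit[OF n(1)] assms(3) by (intro mult_left_mono) auto
    then show ?thesis using n(2) by (simp add: z_H_def)
  qed
qed

text \<open>The ellipse, its vertices and \<open>S_horizontal\<close> are functions of these three
  numbers, so states with a common ellipsoid share them whatever their \<open>z_B\<close>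
  is.\<close>

lemma steering_ellipsoid_determines:
  assumes "X_state \<rho>" "X_state \<rho>'" "steering_ellipsoid \<rho> = steering_ellipsoid \<rho>'"
  shows "ell1 \<rho> = ell1 \<rho>'" "ell3 \<rho> = ell3 \<rho>'" "z_center \<rho> = z_center \<rho>'"
proof -
  note * = steering_ellipsoid_subset[of \<rho> \<rho>'] steering_ellipsoid_subset[of \<rho>' \<rho>]
    ell_nonneg[OF assms(1)] ell_nonneg[OF assms(2)] assms(3)
  from * show "ell1 \<rho> = ell1 \<rho>'" by auto
  from * have "z_G \<rho> = z_G \<rho>'" "z_H \<rho> = z_H \<rho>'" by auto
  then show "ell3 \<rho> = ell3 \<rho>'" "z_center \<rho> = z_center \<rho>'" by (auto simp: z_G_def z_H_def)
qed

lemma norm_vector_3: "norm (vector [x, y, z] :: real^3) = sqrt (x\<^sup>2 + y\<^sup>2 + z\<^sup>2)"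
  by (simp add: norm_vec_def L2_set_def sum_3)

text \<open>As \<open>u\<close> and \<open>v\<close> are nonnegative, the y semiaxis is at most the
  x semiaxis. At a given height the points of the ellipse are thus farthest from the origin and, the
  entropy decreasing with the radius, have least entropy.\<close>

lemma surface_point_entropy:
  assumes X: "X_state \<rho>" and l3: "0 < ell3 \<rho>" and P: "P \<in> steering_surface \<rho>"
  shows "P $ 3 \<in> {z_H \<rho>..z_G \<rho>}" "S_horizontal \<rho> (P $ 3) \<le> point_entropy P"
proof -
  obtain n1 n2 n3 where P: "P = vector [ell1 \<rho> * n1, ell2 \<rho> * n2, z_center \<rho> + ell3 \<rho> * n3]"
    and n: "n1\<^sup>2 + n2\<^sup>2 + n3\<^sup>2 = 1"
    using P unfolding steering_surface_def by blast
  have "n3\<^sup>2 \<le> 1" using n by (smt (verit) zero_le_power2)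
  then have "\<bar>n3\<bar> \<le> 1" by (simp add: abs_square_le_1)
  then have n3: "- 1 \<le> n3" "n3 \<le> 1" by auto
  have "ell3 \<rho> * (- 1) \<le> ell3 \<rho> * n3" "ell3 \<rho> * n3 \<le> ell3 \<rho> * 1"
    using mult_left_mono[of "- 1" n3 "ell3 \<rho>"] mult_left_mono[of n3 1 "ell3 \<rho>"] n3 l3 by simp_all
  then show z: "P $ 3 \<in> {z_H \<rho>..z_G \<rho>}" by (simp add: P z_H_def z_G_def)
  have "(ell2 \<rho>)\<^sup>2 \<le> (ell1 \<rho>)\<^sup>2" using ell_nonneg[OF X] by (intro power_mono) auto
  then have "(ell2 \<rho>)\<^sup>2 * n2\<^sup>2 \<le> (ell1 \<rho>)\<^sup>2 * n2\<^sup>2" by (rule mult_right_mono) simp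
  moreover have "1 - n3\<^sup>2 = n1\<^sup>2 + n2\<^sup>2" using n by simp
  then have "radius_sq (ell1 \<rho>) (ell3 \<rho>) (z_center \<rho>) (P $ 3)
      = (P $ 3)\<^sup>2 + (ell1 \<rho>)\<^sup>2 * n1\<^sup>2 + (ell1 \<rho>)\<^sup>2 * n2\<^sup>2"
    using l3 by (simp add: radius_sq_def P power_mult_distrib distrib_left)
  ultimately have "norm P \<le> sqrt (radius_sq (ell1 \<rho>) (ell3 \<rho>) (z_center \<rho>) (P $ 3))"
    by (simp add: P norm_vector_3 power_mult_distrib)
  then show "S_horizontal \<rho> (P $ 3) \<le> point_entropy P"
    unfolding S_horizontal_eq point_entropy_def
    using radius_sq_le_1[OF X l3 z] by (intro bin_entropy_antimono) auto
qed

lemma ellipse_subset_surface: "steering_ellipse \<rho> \<subseteq> steering_surface \<rho>"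
proof
  fix P assume "P \<in> steering_ellipse \<rho>"
  then obtain n1 n3 where "P = vector [ell1 \<rho> * n1, ell2 \<rho> * 0, z_center \<rho> + ell3 \<rho> * n3]"
    "n1\<^sup>2 + 0\<^sup>2 + n3\<^sup>2 = 1"
    unfolding steering_ellipse_def by auto
  then show "P \<in> steering_surface \<rho>" unfolding steering_surface_def by blast
qed

lemma ellipse_point_entropy:
  assumes l3: "0 < ell3 \<rho>" and P: "P \<in> steering_ellipse \<rho>"
  shows "point_entropy P = S_horizontal \<rho> (P $ 3)"
proof -
  obtain n1 n3 where P: "P = vector [ell1 \<rho> * n1, 0, z_center \<rho> + ell3 \<rho> * n3]"
    and n: "n1\<^sup>2 + n3\<^sup>2 = 1"
    using P unfolding steering_ellipse_def by blast
  have "1 - n3\<^sup>2 = n1\<^sup>2" using n by simp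
  then have "radius_sq (ell1 \<rho>) (ell3 \<rho>) (z_center \<rho>) (P $ 3) = (P $ 3)\<^sup>2 + (ell1 \<rho>)\<^sup>2 * n1\<^sup>2"
    using l3 by (simp add: radius_sq_def P power_mult_distrib)
  then show ?thesis
    by (simp add: S_horizontal_eq point_entropy_def P norm_vector_3 power_mult_distrib add.commute)
qed

definition half_width :: "complex^4^4 \<Rightarrow> real \<Rightarrow> real" where
  "half_width \<rho> z = ell1 \<rho> * sqrt (1 - ((z - z_center \<rho>) / ell3 \<rho>)\<^sup>2)"

text \<open>At a vertex the half width is 0 and the two listed points coincide.\<close>

lemma ellipse_at_height:
  assumes l3: "0 < ell3 \<rho>" and z: "z \<in> {z_H \<rho>..z_G \<rho>}"
  shows "{X \<in> steering_ellipse \<rho>. X $ 3 = z}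
    = {vector [half_width \<rho> z, 0, z], vector [- half_width \<rho> z, 0, z]}"
proof -
  let ?n = "(z - z_center \<rho>) / ell3 \<rho>"
  have "\<bar>?n\<bar> \<le> 1" using z l3 by (auto simp: z_H_def z_G_def abs_le_iff divide_simps)
  then have n: "?n\<^sup>2 \<le> 1" by (simp add: abs_square_le_1)
  have zn: "z_center \<rho> + ell3 \<rho> * ?n = z" using l3 by simp
  have sq: "(sqrt (1 - ?n\<^sup>2))\<^sup>2 + ?n\<^sup>2 = 1" "(- sqrt (1 - ?n\<^sup>2))\<^sup>2 + ?n\<^sup>2 = 1" using n by simp_all
  have "vector [ell1 \<rho> * sqrt (1 - ?n\<^sup>2), 0, z_center \<rho> + ell3 \<rho> * ?n] \<in> steering_ellipse \<rho>"
    "vector [ell1 \<rho> * - sqrt (1 - ?n\<^sup>2), 0, z_center \<rho> + ell3 \<rho> * ?n] \<in> steering_ellipse \<rho>"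
    unfolding steering_ellipse_def using sq by blast+
  then have "vector [half_width \<rho> z, 0, z] \<in> steering_ellipse \<rho>"
    "vector [- half_width \<rho> z, 0, z] \<in> steering_ellipse \<rho>"
    unfolding zn by (simp_all add: half_width_def)
  moreover have "X = vector [half_width \<rho> z, 0, z] \<or> X = vector [- half_width \<rho> z, 0, z]"
    if X: "X \<in> steering_ellipse \<rho>" "X $ 3 = z" for X
  proof -
    obtain n1 n3 where P: "X = vector [ell1 \<rho> * n1, 0, z_center \<rho> + ell3 \<rho> * n3]"
      and n13: "n1\<^sup>2 + n3\<^sup>2 = 1"
      using X unfolding steering_ellipse_def by blast
    have "n3 = ?n" using X(2) l3 by (simp add: P field_simps)
    then have "sqrt (1 - ?n\<^sup>2) = \<bar>n1\<bar>" using n13 by (metis add_diff_cancel_right' real_sqrt_abs)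
    then show ?thesis using X(2) by (auto simp: P half_width_def abs_if)
  qed
  ultimately show ?thesis by auto
qed

lemma half_width_pos:
  assumes "0 < ell1 \<rho>" "0 < ell3 \<rho>" "z \<in> {z_H \<rho><..<z_G \<rho>}"
  shows "0 < half_width \<rho> z"
proof -
  have "\<bar>(z - z_center \<rho>) / ell3 \<rho>\<bar> < 1"
    using assms by (auto simp: z_H_def z_G_def abs_less_iff divide_simps)
  then have "((z - z_center \<rho>) / ell3 \<rho>)\<^sup>2 < 1" by (simp add: abs_square_less_1)
  then show ?thesis using assms(1) by (simp add: half_width_def)
qed

section \<open>Decompositions\<close>

text \<open>Repeated points are merged by adding their weights, because the pair of points at the
  height of a vertex collapses to one point.\<close>

lemma decomposition_of_family:
  fixes F :: "'i \<Rightarrow> real^3"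
  assumes fin: "finite I" and F: "F ` I \<subseteq> steering_surface \<rho>" and w: "\<And>i. i \<in> I \<Longrightarrow> 0 \<le> w i"
    and w1: "sum w I = 1" and bary: "(\<Sum>i\<in>I. w i *\<^sub>R F i) = bloch_B \<rho>"
  obtains S p where "decomposition \<rho> S p" "average_entropy S p = (\<Sum>i\<in>I. w i * point_entropy (F i))"
proof
  define p where "p P = sum w {i \<in> I. F i = P}" for P
  have *: "(\<Sum>P\<in>F ` I. p P *\<^sub>R g P) = (\<Sum>i\<in>I. w i *\<^sub>R g (F i))" for g :: "real^3 \<Rightarrow> 'b::real_vector"
    unfolding sum.image_gen[OF fin, of "\<lambda>i. w i *\<^sub>R g (F i)" F] p_def scaleR_sum_left
    by (intro sum.cong) auto
  show "decomposition \<rho> (F ` I) p"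
    unfolding decomposition_def
  proof (intro conjI ballI)
    show "sum p (F ` I) = 1" using *[of "\<lambda>_. 1 :: real"] w1 by simp
    show "(\<Sum>P\<in>F ` I. p P *\<^sub>R P) = bloch_B \<rho>" using *[of "\<lambda>P. P"] bary by simp
  qed (use fin F w in \<open>auto simp: p_def intro!: sum_nonneg\<close>)
  show "average_entropy (F ` I) p = (\<Sum>i\<in>I. w i * point_entropy (F i))"
    using *[of point_entropy] by (simp add: average_entropy_def)
qed

lemma height_points:
  assumes "0 < ell3 \<rho>" "z \<in> {z_H \<rho>..z_G \<rho>}" "\<bar>s\<bar> = 1"
  shows "vector [s * half_width \<rho> z, 0, z] \<in> steering_ellipse \<rho>"
    "point_entropy (vector [s * half_width \<rho> z, 0, z]) = S_horizontal \<rho> z"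
proof -
  have "s = 1 \<or> s = - 1" using assms(3) by linarith
  then have "vector [s * half_width \<rho> z, 0, z] \<in> {X \<in> steering_ellipse \<rho>. X $ 3 = z}"
    unfolding ellipse_at_height[OF assms(1,2)] by auto
  then show *: "vector [s * half_width \<rho> z, 0, z] \<in> steering_ellipse \<rho>" by simp
  show "point_entropy (vector [s * half_width \<rho> z, 0, z]) = S_horizontal \<rho> z"
    using ellipse_point_entropy[OF assms(1) *] by simp
qed

text \<open>Two points at each of the heights \<open>x\<close> and \<open>y\<close>, equally
  weighted within each pair, cancel horizontally; the weight \<open>l\<close> of height
  \<open>x\<close> puts the barycentre at \<open>z_B\<close>. For \<open>x = z_B\<close> the pair at
  \<open>y\<close> gets weight 0.\<close>

lemma chord_decomposition:
  assumes l3: "0 < ell3 \<rho>" and xy: "z_H \<rho> \<le> x" "x \<le> z_B \<rho>" "z_B \<rho> \<le> y" "y \<le> z_G \<rho>" "x < y"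
  obtains S p where "decomposition \<rho> S p" "average_entropy S p = chord (S_horizontal \<rho>) x y (z_B \<rho>)"
proof -
  define z where "z h = (if h then x else y)" for h :: bool
  define s where "s k = (if k then 1 else - 1 :: real)" for k :: bool
  define F :: "bool \<times> bool \<Rightarrow> real^3" where
    "F = (\<lambda>(h, k). vector [s k * half_width \<rho> (z h), 0, z h])"
  define l where "l = (y - z_B \<rho>) / (y - x)"
  define w where "w = (\<lambda>(h, k :: bool). (if h then l else 1 - l) / 2)"
  have l01: "0 \<le> l" "l \<le> 1" using xy by (simp_all add: l_def)
  have l': "1 - l = (z_B \<rho> - x) / (y - x)" using xy by (simp add: l_def field_simps)
  have lz: "l * x + (1 - l) * y = z_B \<rho>"
  proof -
    have "l * (y - x) = y - z_B \<rho>" using xy by (simp add: l_def)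
    then show ?thesis by (simp add: algebra_simps)
  qed
  have z: "z h \<in> {z_H \<rho>..z_G \<rho>}" for h using xy by (simp add: z_def)
  have s: "\<bar>s k\<bar> = 1" for k by (simp add: s_def)
  have U: "(\<Sum>i\<in>UNIV. f i) = f (True, True) + f (True, False) + f (False, True) + f (False, False)"
    for f :: "bool \<times> bool \<Rightarrow> 'b::ab_group_add"
    by (simp add: UNIV_Times_UNIV[symmetric] sum.cartesian_product[symmetric] UNIV_bool add_ac
        del: UNIV_Times_UNIV)
  obtain S p where Sp: "decomposition \<rho> S p"
    "average_entropy S p = (\<Sum>i\<in>UNIV. w i * point_entropy (F i))"
  proof (rule decomposition_of_family[of "UNIV :: (bool \<times> bool) set" F \<rho> w])
    show "range F \<subseteq> steering_surface \<rho>"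
      using height_points(1)[OF l3 z s] ellipse_subset_surface[of \<rho>] by (auto simp: F_def)
    show "0 \<le> w i" for i using l01 by (auto simp: w_def split: prod.split)
    show "sum w UNIV = 1" by (simp add: U w_def field_simps)
    show "(\<Sum>i\<in>UNIV. w i *\<^sub>R F i) = bloch_B \<rho>"
      using lz by (simp add: U w_def F_def bloch_B_def vec_eq_iff forall_3 s_def z_def field_simps)
  qed auto
  have "average_entropy S p = l * S_horizontal \<rho> x + (1 - l) * S_horizontal \<rho> y"
    unfolding Sp(2) U w_def F_def prod.case height_points(2)[OF l3 z s]
    by (simp add: z_def field_simps)
  also have "\<dots> = chord (S_horizontal \<rho>) x y (z_B \<rho>)"
    unfolding l' chord_def by (simp add: l_def add_divide_distrib)
  finally show thesis using that Sp(1) by blast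
qed

lemma decomposition_z_B:
  assumes "decomposition \<rho> S p"
  shows "(\<Sum>P\<in>S. p P * P $ 3) = z_B \<rho>"
proof -
  have "(\<Sum>P\<in>S. p P *\<^sub>R P) $ 3 = z_B \<rho>"
    using assms by (simp add: decomposition_def bloch_B_def)
  then show ?thesis by simp
qed

text \<open>An affine function of the height averages to its value at \<open>z_B\<close> over every
  decomposition.\<close>

lemma average_entropy_ge:
  assumes X: "X_state \<rho>" and l3: "0 < ell3 \<rho>" and dec: "decomposition \<rho> S p"
    and line: "\<And>z. z_H \<rho> \<le> z \<Longrightarrow> z \<le> z_G \<rho> \<Longrightarrow> m * z + n \<le> S_horizontal \<rho> z"
  shows "m * z_B \<rho> + n \<le> average_entropy S p"
proof -
  have d: "\<And>P. P \<in> S \<Longrightarrow> P \<in> steering_surface \<rho>" "\<And>P. P \<in> S \<Longrightarrow> 0 \<le> p P" "sum p S = 1"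
    using dec by (auto simp: decomposition_def)
  have "m * z_B \<rho> + n = m * (\<Sum>P\<in>S. p P * P $ 3) + n * sum p S"
    by (simp add: decomposition_z_B[OF dec] d(3))
  also have "\<dots> = (\<Sum>P\<in>S. p P * (m * P $ 3 + n))"
    by (simp add: sum_distrib_left distrib_left sum.distrib mult_ac)
  also have "\<dots> \<le> (\<Sum>P\<in>S. p P * point_entropy P)"
  proof (intro sum_mono mult_left_mono)
    fix P assume "P \<in> S"
    then show "m * P $ 3 + n \<le> point_entropy P"
      using surface_point_entropy[OF X l3 d(1)] line[of "P $ 3"] by force
  qed (use d in auto)
  finally show ?thesis by (simp add: average_entropy_def)
qed

lemma vertex_in_ellipse:
  assumes "h = z_G \<rho> \<or> h = z_H \<rho>"
  shows "vector [0, 0, h] \<in> steering_ellipse \<rho>"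
proof -
  have "h = z_center \<rho> + ell3 \<rho> * 1 \<or> h = z_center \<rho> + ell3 \<rho> * (- 1)"
    using assms by (auto simp: z_G_def z_H_def)
  then obtain e where "h = z_center \<rho> + ell3 \<rho> * e" "e = 1 \<or> e = - 1" by blast
  then have "vector [0, 0, h] = (vector [ell1 \<rho> * 0, 0, z_center \<rho> + ell3 \<rho> * e] :: real^3)"
    "0\<^sup>2 + e\<^sup>2 = 1" by auto
  then show ?thesis unfolding steering_ellipse_def by blast
qed

text \<open>The height of the barycentre fixes the weight of the vertex. Both orders of
  \<open>t\<close> and \<open>h\<close> are covered, as \<open>chord\<close> is symmetric in its end
  points.\<close>

lemma vertex_triangle_average:
  assumes l3: "0 < ell3 \<rho>" and dec: "decomposition \<rho> S p" and S: "S = {vector [0, 0, h], P, Q}"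
    and h: "h = z_G \<rho> \<or> h = z_H \<rho>" and "t \<noteq> h" and "P \<noteq> Q"
    and PQ: "P \<in> steering_ellipse \<rho>" "Q \<in> steering_ellipse \<rho>" "P $ 3 = t" "Q $ 3 = t"
  shows "average_entropy S p = chord (S_horizontal \<rho>) t h (z_B \<rho>)"
proof -
  let ?V = "vector [0, 0, h] :: real^3"
  have V3: "?V $ 3 = h" by simp
  have ne: "?V \<noteq> P" "?V \<noteq> Q" using PQ \<open>t \<noteq> h\<close> V3 by metis+
  have sum3: "sum f S = f ?V + (f P + f Q)" for f :: "real^3 \<Rightarrow> real"
    unfolding S using ne \<open>P \<noteq> Q\<close> by simp
  have "sum p S = 1" using dec by (simp add: decomposition_def)
  then have 1: "p ?V = 1 - (p P + p Q)" using sum3[of p] by simp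
  have 2: "p ?V * h + (p P + p Q) * t = z_B \<rho>"
    using decomposition_z_B[OF dec] by (simp add: sum3 PQ distrib_right)
  define q where "q = p P + p Q"
  have q: "q * (h - t) = h - z_B \<rho>" using 2 unfolding 1 q_def[symmetric] by (simp add: algebra_simps)
  have "average_entropy S p = p ?V * S_horizontal \<rho> h + (p P + p Q) * S_horizontal \<rho> t"
    using ellipse_point_entropy[OF l3 vertex_in_ellipse[OF h]] ellipse_point_entropy[OF l3 PQ(1)]
      ellipse_point_entropy[OF l3 PQ(2)]
    by (simp add: average_entropy_def sum3 PQ distrib_right)
  also have "\<dots> = (1 - q) * S_horizontal \<rho> h + q * S_horizontal \<rho> t" unfolding 1 q_def ..
  also have "q = (h - z_B \<rho>) / (h - t)" using q \<open>t \<noteq> h\<close> by (simp add: field_simps)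
  also have "1 - (h - z_B \<rho>) / (h - t) = (z_B \<rho> - t) / (h - t)" using \<open>t \<noteq> h\<close> by (simp add: field_simps)
  finally show ?thesis by (simp add: chord_def add_divide_distrib)
qed

section \<open>Optimal decompositions and optimal chords\<close>

lemma chord_commute: "chord f x y z = chord f y x z"
proof -
  have "chord f y x z = (- ((y - z) * f x + (z - x) * f y)) / (- (y - x))"
    by (simp add: chord_def algebra_simps)
  then show ?thesis by (simp only: minus_divide_divide chord_def)
qed

text \<open>Every chord over \<open>z_B\<close> is a competitor, since some decomposition of the
  same state realises it.\<close>

lemma optimal_imp_chord_optimal:
  assumes l3: "0 < ell3 \<rho>" and opt: "optimal_decomposition \<rho> S p"
    and avg: "average_entropy S p = chord (S_horizontal \<rho>) x y (z_B \<rho>)"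
  shows "chord_optimal (S_horizontal \<rho>) (z_H \<rho>) (z_G \<rho>) x y (z_B \<rho>)"
  unfolding chord_optimal_def
proof (intro allI impI)
  fix x' y' assume "z_H \<rho> \<le> x' \<and> x' \<le> z_B \<rho> \<and> z_B \<rho> \<le> y' \<and> y' \<le> z_G \<rho> \<and> x' < y'"
  then obtain S' p' where "decomposition \<rho> S' p'"
    "average_entropy S' p' = chord (S_horizontal \<rho>) x' y' (z_B \<rho>)"
    using chord_decomposition[OF l3, of x' y'] by blast
  then show "chord (S_horizontal \<rho>) x y (z_B \<rho>) \<le> chord (S_horizontal \<rho>) x' y' (z_B \<rho>)"
    using opt avg unfolding optimal_decomposition_def by metis
qed

lemma upper_triangle_chord_optimal:
  assumes l3: "0 < ell3 \<rho>" and opt: "optimal_decomposition \<rho> S p" and up: "upper_triangle \<rho> S p"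
    and zB: "z_B \<rho> < z_G \<rho>"
  obtains z1 where "z_H \<rho> < z1" "z1 < z_B \<rho>"
    "chord_optimal (S_horizontal \<rho>) (z_H \<rho>) (z_G \<rho>) z1 (z_G \<rho>) (z_B \<rho>)"
    "S = insert (vertex_G \<rho>) {X \<in> steering_ellipse \<rho>. X $ 3 = z1}"
proof -
  obtain z1 P Q where z1: "z_H \<rho> < z1" "z1 < z_B \<rho>" and "P \<noteq> Q"
    and PQ: "{X \<in> steering_ellipse \<rho>. X $ 3 = z1} = {P, Q}" and S: "S = {vertex_G \<rho>, P, Q}"
    using up unfolding upper_triangle_def by auto
  have mem: "P \<in> {X \<in> steering_ellipse \<rho>. X $ 3 = z1}" "Q \<in> {X \<in> steering_ellipse \<rho>. X $ 3 = z1}"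
    unfolding PQ by auto
  have "decomposition \<rho> S p" using opt by (simp add: optimal_decomposition_def)
  then have "average_entropy S p = chord (S_horizontal \<rho>) z1 (z_G \<rho>) (z_B \<rho>)"
    using vertex_triangle_average[OF l3 _ S[unfolded vertex_G_def], of p z1] mem \<open>P \<noteq> Q\<close> z1 zB by auto
  then show thesis
    using that[OF z1 optimal_imp_chord_optimal[OF l3 opt]] S PQ by simp
qed

lemma lower_triangle_chord_optimal:
  assumes l3: "0 < ell3 \<rho>" and opt: "optimal_decomposition \<rho> S p" and low: "lower_triangle \<rho> S p"
    and zB: "z_H \<rho> < z_B \<rho>"
  obtains z2 where "z_B \<rho> < z2" "z2 < z_G \<rho>"
    "chord_optimal (S_horizontal \<rho>) (z_H \<rho>) (z_G \<rho>) (z_H \<rho>) z2 (z_B \<rho>)"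
    "S = insert (vertex_H \<rho>) {X \<in> steering_ellipse \<rho>. X $ 3 = z2}"
proof -
  obtain z2 P Q where z2: "z_B \<rho> < z2" "z2 < z_G \<rho>" and "P \<noteq> Q"
    and PQ: "{X \<in> steering_ellipse \<rho>. X $ 3 = z2} = {P, Q}" and S: "S = {vertex_H \<rho>, P, Q}"
    using low unfolding lower_triangle_def by auto
  have mem: "P \<in> {X \<in> steering_ellipse \<rho>. X $ 3 = z2}" "Q \<in> {X \<in> steering_ellipse \<rho>. X $ 3 = z2}"
    unfolding PQ by auto
  have "decomposition \<rho> S p" using opt by (simp add: optimal_decomposition_def)
  then have "average_entropy S p = chord (S_horizontal \<rho>) z2 (z_H \<rho>) (z_B \<rho>)"
    using vertex_triangle_average[OF l3 _ S[unfolded vertex_H_def], of p z2] mem \<open>P \<noteq> Q\<close> z2 zB by auto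
  then have "average_entropy S p = chord (S_horizontal \<rho>) (z_H \<rho>) z2 (z_B \<rho>)"
    by (simp only: chord_commute)
  then show thesis
    using that[OF z2 optimal_imp_chord_optimal[OF l3 opt]] S PQ by simp
qed

text \<open>The two quotients are the weights of the vertex and of the pair at height
  \<open>T\<close>; their positivity places \<open>z_B\<close> strictly between \<open>T\<close> and
  \<open>h\<close>, whichever is higher. The average then equals the value of the line at
  \<open>z_B\<close>, which bounds all decompositions from below.\<close>

lemma supporting_line_imp_optimal:
  assumes X: "X_state \<rho>" and l3: "0 < ell3 \<rho>" and l1: "0 < ell1 \<rho>"
    and h: "h = z_G \<rho> \<or> h = z_H \<rho>" and T: "z_H \<rho> < T" "T < z_G \<rho>"
    and zB: "0 < (z_B \<rho> - T) / (h - T)" "0 < (h - z_B \<rho>) / (h - T)"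
    and line: "S_horizontal \<rho> T = m * T + n" "S_horizontal \<rho> h = m * h + n"
      "\<And>z. z_H \<rho> \<le> z \<Longrightarrow> z \<le> z_G \<rho> \<Longrightarrow> m * z + n \<le> S_horizontal \<rho> z"
  obtains P Q p where "P \<noteq> Q" "{X \<in> steering_ellipse \<rho>. X $ 3 = T} = {P, Q}" "p P = p Q"
    "\<forall>R \<in> {vector [0, 0, h], P, Q}. 0 < p R"
    "optimal_decomposition \<rho> {vector [0, 0, h], P, Q} p"
proof -
  define V P Q :: "real^3" where "V = vector [0, 0, h]"
    and "P = vector [half_width \<rho> T, 0, T]" and "Q = vector [- half_width \<rho> T, 0, T]"
  define \<mu> where "\<mu> = (z_B \<rho> - T) / (h - T)"
  define p where "p R = (if R = V then \<mu> else (1 - \<mu>) / 2)" for R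
  have hT: "h \<noteq> T" using h T by auto
  have \<mu>1: "1 - \<mu> = (h - z_B \<rho>) / (h - T)" using hT by (simp add: \<mu>_def field_simps)
  have "\<mu> * (h - T) = z_B \<rho> - T" using hT by (simp add: \<mu>_def)
  then have \<mu>z: "\<mu> * h + (1 - \<mu>) * T = z_B \<rho>" by (simp add: algebra_simps)
  have hw: "0 < half_width \<rho> T" using half_width_pos[OF l1 l3] T by simp
  have sec: "{X \<in> steering_ellipse \<rho>. X $ 3 = T} = {P, Q}"
    unfolding P_def Q_def using ellipse_at_height[OF l3] T by simp
  have "P $ 1 \<noteq> Q $ 1" "P $ 3 \<noteq> V $ 3" "Q $ 3 \<noteq> V $ 3"
    using hw hT by (simp_all add: P_def Q_def V_def)
  then have ne: "P \<noteq> Q" "P \<noteq> V" "Q \<noteq> V" by auto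
  have PQ: "P \<in> steering_ellipse \<rho>" "Q \<in> steering_ellipse \<rho>" "P $ 3 = T" "Q $ 3 = T"
    using sec by auto
  have V: "V \<in> steering_ellipse \<rho>" unfolding V_def by (rule vertex_in_ellipse[OF h])
  have p: "p V = \<mu>" "p P = (1 - \<mu>) / 2" "p Q = (1 - \<mu>) / 2" using ne by (simp_all add: p_def)
  have "0 < \<mu>" "0 < 1 - \<mu>" using zB unfolding \<mu>1 by (simp_all add: \<mu>_def)
  then have pos: "0 < p R" for R by (simp add: p_def)
  have dec: "decomposition \<rho> {V, P, Q} p"
    unfolding decomposition_def
  proof (intro conjI ballI)
    show "{V, P, Q} \<subseteq> steering_surface \<rho>" using V PQ ellipse_subset_surface by blast
    show "0 \<le> p R" for R using pos[of R] by simp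
    have sum3: "sum f {V, P, Q} = f V + (f P + f Q)" for f :: "real^3 \<Rightarrow> 'b::comm_monoid_add"
      using ne by simp
    show "sum p {V, P, Q} = 1" by (simp only: sum3 p) simp
    show "(\<Sum>R\<in>{V, P, Q}. p R *\<^sub>R R) = bloch_B \<rho>"
      unfolding sum3 p using \<mu>z
      by (simp add: vec_eq_iff forall_3 bloch_B_def V_def P_def Q_def) (simp add: field_simps)
  qed simp
  have "average_entropy {V, P, Q} p = chord (S_horizontal \<rho>) T h (z_B \<rho>)"
    using vertex_triangle_average[OF l3 dec _ h, of P Q T] hT ne PQ by (auto simp: V_def)
  also have "\<dots> = (1 - \<mu>) * (m * T + n) + \<mu> * (m * h + n)"
    unfolding \<mu>1 by (simp add: chord_def \<mu>_def line(1,2) add_divide_distrib)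
  also have "\<dots> = m * z_B \<rho> + n" unfolding \<mu>z[symmetric] by (simp add: algebra_simps)
  finally have "optimal_decomposition \<rho> {V, P, Q} p"
    using dec average_entropy_ge[OF X l3 _ line(3)] by (simp add: optimal_decomposition_def)
  then show thesis using that[of P Q p] ne sec p pos by (simp add: V_def)
qed

lemma steering_parameters_cong:
  assumes "ell1 \<rho> = ell1 \<rho>'" "ell3 \<rho> = ell3 \<rho>'" "z_center \<rho> = z_center \<rho>'"
  shows "S_horizontal \<rho> = S_horizontal \<rho>'" "z_G \<rho> = z_G \<rho>'" "z_H \<rho> = z_H \<rho>'"
    "vertex_G \<rho> = vertex_G \<rho>'" "vertex_H \<rho> = vertex_H \<rho>'" "steering_ellipse \<rho> = steering_ellipse \<rho>'"
  using assms by (simp_all add: S_horizontal_def[abs_def] z_G_def z_H_def vertex_G_def vertex_H_def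
      steering_ellipse_def)

section \<open>The fixed triangle and the states that realise it\<close>

theorem proposition3:
  fixes \<rho>0 :: "complex^4^4"
  assumes "X_state \<rho>0"
    and "ell3 \<rho>0 > 0"
    and "\<not> (\<forall>z\<in>{z_H \<rho>0<..<z_G \<rho>0}. S_horizontal \<rho>0 z > S_vertical \<rho>0 z)"
    and "\<not> convex_on {z_H \<rho>0..z_G \<rho>0} (S_horizontal \<rho>0)"
    and "\<not> concave_on {z_H \<rho>0..z_G \<rho>0} (S_horizontal \<rho>0)"
  shows "(\<exists>\<rho> S p. X_state \<rho> \<and> steering_ellipsoid \<rho> = steering_ellipsoid \<rho>0 \<and>
            three_state_decomposition \<rho> S p \<and> optimal_decomposition \<rho> S p) \<and>
         (\<exists>B1\<in>steering_ellipse \<rho>0. \<exists>B2\<in>steering_ellipse \<rho>0. \<exists>B3\<in>steering_ellipse \<rho>0.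
            \<forall>\<rho> S p. X_state \<rho> \<and> steering_ellipsoid \<rho> = steering_ellipsoid \<rho>0 \<and>
              three_state_decomposition \<rho> S p \<and> optimal_decomposition \<rho> S p
              \<longrightarrow> S = {B1, B2, B3})"
proof -
  let ?g = "S_horizontal \<rho>0" and ?H = "z_H \<rho>0" and ?G = "z_G \<rho>0"
  note X = assms(1) and l3 = assms(2)
  have g: "?g = (\<lambda>z. bin_entropy (sqrt (radius_sq (ell1 \<rho>0) (ell3 \<rho>0) (z_center \<rho>0) z)))"
    by (simp add: fun_eq_iff S_horizontal_eq)
  have q: "radius_sq (ell1 \<rho>0) (ell3 \<rho>0) (z_center \<rho>0) z \<le> 1"
    if "z \<in> {z_center \<rho>0 - ell3 \<rho>0..z_center \<rho>0 + ell3 \<rho>0}" for z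
    using radius_sq_le_1[OF X l3] that by (simp add: z_H_def z_G_def)
  have "ell3 \<rho>0 < ell1 \<rho>0"
    using horizontal_concave[OF l3 ell_nonneg(3)[OF X] _ q] assms(5) g
    by (force simp: z_H_def z_G_def not_less[symmetric])
  then have l1: "0 < ell1 \<rho>0" using l3 by simp
  have cont: "continuous_on {?H..?G} ?g"
    using continuous_on_horizontal[OF l3 q] by (simp add: g z_H_def z_G_def)
  \<comment> \<open>The vertices lie on the ellipse, so the vertical average is the chord of
    \<open>S_horizontal\<close> over the whole interval, and \<open>z0\<close> is a height where
    \<open>S_horizontal\<close> is not above it.\<close>
  have vert: "S_vertical \<rho>0 z = chord ?g ?H ?G z" for z
    using ellipse_point_entropy[OF l3 vertex_in_ellipse[of ?G \<rho>0]]
      ellipse_point_entropy[OF l3 vertex_in_ellipse[of ?H \<rho>0]]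
    by (simp add: S_vertical_def chord_def vertex_G_def vertex_H_def add_divide_distrib)
  obtain z0 where z0: "?H < z0" "z0 < ?G" "?g z0 \<le> chord ?g ?H ?G z0"
    using assms(3) by (auto simp: vert not_less)
  have shift: "\<exists>\<rho>. X_state \<rho> \<and> steering_ellipsoid \<rho> = steering_ellipsoid \<rho>0 \<and> z_B \<rho> = z"
    if z: "?H < z" "z < ?G" for z
  proof -
    obtain \<rho> where "X_state \<rho>" "ell1 \<rho> = ell1 \<rho>0" "ell2 \<rho> = ell2 \<rho>0" "ell3 \<rho> = ell3 \<rho>0"
      "z_center \<rho> = z_center \<rho>0" "z_B \<rho> = z"
      by (rule X_state_with_z_B[OF X l3 z])
    then show ?thesis by (intro exI[of _ \<rho>]) (simp add: steering_ellipsoid_def)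
  qed
  \<comment> \<open>Both orientations end alike: \<open>h\<close> will be the vertex on the concave
    side, \<open>T\<close> the contact height and \<open>m * z + n\<close> the supporting line.
    Existence comes from the line, the common components from \<open>uniq\<close>.\<close>
  have finish: ?thesis
    if h: "h = ?G \<or> h = ?H" and T: "?H < T" "T < ?G" "?g T = m * T + n" "?g h = m * h + n"
        "\<And>z. ?H \<le> z \<Longrightarrow> z \<le> ?G \<Longrightarrow> m * z + n \<le> ?g z"
      and uniq: "\<And>\<rho> S p. X_state \<rho> \<Longrightarrow> steering_ellipsoid \<rho> = steering_ellipsoid \<rho>0 \<Longrightarrow>
        three_state_decomposition \<rho> S p \<Longrightarrow> optimal_decomposition \<rho> S p \<Longrightarrow>
        S = insert (vector [0, 0, h]) {X \<in> steering_ellipse \<rho>0. X $ 3 = T}"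
    for h T m n :: real
  proof (intro conjI)
    \<comment> \<open>Midway between \<open>T\<close> and \<open>h\<close>, the vertex and the pair
      each receive total weight 1/2.\<close>
    obtain \<rho> where \<rho>: "X_state \<rho>" "steering_ellipsoid \<rho> = steering_ellipsoid \<rho>0"
      and zB: "z_B \<rho> = (T + h) / 2"
      using shift[of "(T + h) / 2"] T h by auto
    note eq = steering_ellipsoid_determines[OF \<rho>(1) X \<rho>(2)]
    note cong = steering_parameters_cong[OF eq]
    have hT: "h \<noteq> T" using h T by auto
    obtain P Q p where PQ: "P \<noteq> Q" "{X \<in> steering_ellipse \<rho>. X $ 3 = T} = {P, Q}" "p P = p Q"
      "\<forall>R \<in> {vector [0, 0, h], P, Q}. 0 < p R"
      "optimal_decomposition \<rho> {vector [0, 0, h], P, Q} p"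
    proof (rule supporting_line_imp_optimal[OF \<rho>(1), of h T m n])
      have "z_B \<rho> - T = (h - T) / 2" "h - z_B \<rho> = (h - T) / 2" by (simp_all add: zB field_simps)
      with hT have half: "(z_B \<rho> - T) / (h - T) = 1 / 2" "(h - z_B \<rho>) / (h - T) = 1 / 2"
        by (simp_all only: divide_divide_eq_left') (simp_all add: divide_simps)
      show "0 < (z_B \<rho> - T) / (h - T)" "0 < (h - z_B \<rho>) / (h - T)"
        unfolding half by simp_all
    qed (use eq l3 l1 cong h T in auto)
    let ?S = "{vector [0, 0, h], P, Q}"
    have "upper_triangle \<rho> ?S p \<or> lower_triangle \<rho> ?S p"
      using h
    proof
      assume h: "h = ?G"
      have T': "T \<in> {z_H \<rho><..<z_B \<rho>}" using T zB by (simp add: cong h)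
      have V: "vertex_G \<rho> = vector [0, 0, h]" by (simp add: vertex_G_def cong h)
      show ?thesis unfolding upper_triangle_def V
        by (intro disjI1 bexI[OF _ T'] exI[of _ P] exI[of _ Q] conjI PQ(1-3) refl)
    next
      assume h: "h = ?H"
      have T': "T \<in> {z_B \<rho><..<z_G \<rho>}" using T zB by (simp add: cong h)
      have V: "vertex_H \<rho> = vector [0, 0, h]" by (simp add: vertex_H_def cong h)
      show ?thesis unfolding lower_triangle_def V
        by (intro disjI2 bexI[OF _ T'] exI[of _ P] exI[of _ Q] conjI PQ(1-3) refl)
    qed
    then have "three_state_decomposition \<rho> ?S p"
      using PQ(4,5) by (simp add: three_state_decomposition_def optimal_decomposition_def)
    then show "\<exists>\<rho> S p. X_state \<rho> \<and> steering_ellipsoid \<rho> = steering_ellipsoid \<rho>0 \<and>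
        three_state_decomposition \<rho> S p \<and> optimal_decomposition \<rho> S p"
      using \<rho> PQ(5) by blast
  next
    obtain P Q where sec: "{X \<in> steering_ellipse \<rho>0. X $ 3 = T} = {P, Q}"
      using ellipse_at_height[OF l3, of T] T by fastforce
    have "vector [0, 0, h] \<in> steering_ellipse \<rho>0" "P \<in> steering_ellipse \<rho>0" "Q \<in> steering_ellipse \<rho>0"
      using sec vertex_in_ellipse[OF h] by auto
    then show "\<exists>B1\<in>steering_ellipse \<rho>0. \<exists>B2\<in>steering_ellipse \<rho>0. \<exists>B3\<in>steering_ellipse \<rho>0.
        \<forall>\<rho> S p. X_state \<rho> \<and> steering_ellipsoid \<rho> = steering_ellipsoid \<rho>0 \<and>
          three_state_decomposition \<rho> S p \<and> optimal_decomposition \<rho> S p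
          \<longrightarrow> S = {B1, B2, B3}"
      using uniq unfolding sec by blast
  qed
  \<comment> \<open>An optimal triangle of any state with this ellipsoid becomes an optimal chord
    for the data of \<open>\<rho>0\<close>; only \<open>z_B\<close> still refers to
    \<open>\<rho>\<close>.\<close>
  have triangle: "(\<exists>z1. ?H < z1 \<and> z1 < z_B \<rho> \<and> chord_optimal ?g ?H ?G z1 ?G (z_B \<rho>) \<and>
        S = insert (vector [0, 0, ?G]) {X \<in> steering_ellipse \<rho>0. X $ 3 = z1}) \<or>
      (\<exists>z2. z_B \<rho> < z2 \<and> z2 < ?G \<and> chord_optimal ?g ?H ?G ?H z2 (z_B \<rho>) \<and>
        S = insert (vector [0, 0, ?H]) {X \<in> steering_ellipse \<rho>0. X $ 3 = z2})"
    and zB: "?H < z_B \<rho>" "z_B \<rho> < ?G"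
    if \<rho>: "X_state \<rho>" "steering_ellipsoid \<rho> = steering_ellipsoid \<rho>0"
      and S: "three_state_decomposition \<rho> S p" "optimal_decomposition \<rho> S p" for \<rho> S p
  proof -
    note eq = steering_ellipsoid_determines[OF \<rho>(1) X \<rho>(2)]
    have l3': "0 < ell3 \<rho>" using eq l3 by simp
    note cong = steering_parameters_cong[OF eq]
    note zB' = z_B_between[OF \<rho>(1) l3']
    from zB' show "?H < z_B \<rho>" "z_B \<rho> < ?G" by (simp_all add: cong)
    have "upper_triangle \<rho> S p \<or> lower_triangle \<rho> S p"
      using S(1) by (simp add: three_state_decomposition_def)
    then show "(\<exists>z1. ?H < z1 \<and> z1 < z_B \<rho> \<and> chord_optimal ?g ?H ?G z1 ?G (z_B \<rho>) \<and>
        S = insert (vector [0, 0, ?G]) {X \<in> steering_ellipse \<rho>0. X $ 3 = z1}) \<or>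
      (\<exists>z2. z_B \<rho> < z2 \<and> z2 < ?G \<and> chord_optimal ?g ?H ?G ?H z2 (z_B \<rho>) \<and>
        S = insert (vector [0, 0, ?H]) {X \<in> steering_ellipse \<rho>0. X $ 3 = z2})"
    proof
      assume "upper_triangle \<rho> S p"
      from upper_triangle_chord_optimal[OF l3' S(2) this zB'(2)] show ?thesis
        unfolding cong unfolding vertex_G_def by blast
    next
      assume "lower_triangle \<rho> S p"
      from lower_triangle_chord_optimal[OF l3' S(2) this zB'(1)] show ?thesis
        unfolding cong unfolding vertex_H_def by blast
    qed
  qed
  consider (up) c where "?H < c" "c < ?G" "strictly_convex ?H c ?g" "strictly_concave c ?G ?g"
    | (low) c where "?H < c" "c < ?G" "strictly_concave ?H c ?g" "strictly_convex c ?G ?g"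
    using horizontal_shape[OF l3 \<open>ell3 \<rho>0 < ell1 \<rho>0\<close> q] assms(4,5)
    unfolding g z_H_def z_G_def by metis
  then show ?thesis
  proof cases
    case up
    obtain T m n where T: "?H < T" "T < ?G" "?g T = m * T + n" "?g ?G = m * ?G + n"
      "\<And>z. ?H \<le> z \<Longrightarrow> z \<le> ?G \<Longrightarrow> m * z + n \<le> ?g z"
      and uniq: "\<And>z z1. ?H < z1 \<Longrightarrow> z1 < z \<Longrightarrow> z < ?G \<Longrightarrow> chord_optimal ?g ?H ?G z1 ?G z \<Longrightarrow> z1 = T"
      and no: "\<And>z z2. ?H < z \<Longrightarrow> z < z2 \<Longrightarrow> z2 < ?G \<Longrightarrow> \<not> chord_optimal ?g ?H ?G ?H z2 z"
      using convex_concave_envelope[OF up(1,2) cont up(3,4) z0] by blast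
    show ?thesis
    proof (rule finish[OF disjI1[OF refl] T])
      fix \<rho> S p
      assume "X_state \<rho>" "steering_ellipsoid \<rho> = steering_ellipsoid \<rho>0"
        "three_state_decomposition \<rho> S p" "optimal_decomposition \<rho> S p"
      \<comment> \<open>In this orientation \<open>no\<close> refutes a lower triangle, and
        \<open>uniq\<close> puts the base of an upper one at height \<open>T\<close>.\<close>
      note * = triangle[OF this] zB[OF this]
      then show "S = insert (vector [0, 0, ?G]) {X \<in> steering_ellipse \<rho>0. X $ 3 = T}"
        using uniq no by blast
    qed
  next
    case low
    obtain T m n where T: "?H < T" "T < ?G" "?g T = m * T + n" "?g ?H = m * ?H + n"
      "\<And>z. ?H \<le> z \<Longrightarrow> z \<le> ?G \<Longrightarrow> m * z + n \<le> ?g z"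
      and uniq: "\<And>z z2. ?H < z \<Longrightarrow> z < z2 \<Longrightarrow> z2 < ?G \<Longrightarrow> chord_optimal ?g ?H ?G ?H z2 z \<Longrightarrow> z2 = T"
      and no: "\<And>z z1. ?H < z1 \<Longrightarrow> z1 < z \<Longrightarrow> z < ?G \<Longrightarrow> \<not> chord_optimal ?g ?H ?G z1 ?G z"
      using concave_convex_envelope[OF low(1,2) cont low(3,4) z0] by blast
    show ?thesis
    proof (rule finish[OF disjI2[OF refl] T])
      fix \<rho> S p
      assume "X_state \<rho>" "steering_ellipsoid \<rho> = steering_ellipsoid \<rho>0"
        "three_state_decomposition \<rho> S p" "optimal_decomposition \<rho> S p"
      note * = triangle[OF this] zB[OF this]
      then show "S = insert (vector [0, 0, ?H]) {X \<in> steering_ellipse \<rho>0. X $ 3 = T}"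
        using uniq no by blast
    qed
  qed
qed

end
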